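(* (In neutral constructive geometry, with intuitionistic logic.) Assume Euclid 5. There is a term $\mathrm{Reflect}(x,L)$ (a ruler-and-compass construction) that produces the reflection of the point $x$ in the line $L$, without a case distinction whether $x$ is on $L$ or not. That is, $\mathrm{Reflect}(x,L)$ is defined for all $x$ and $L$, and if $z=\mathrm{Reflect}(x,L)$ and the line $K$ perpendicular to $L$ contains $x$ and meets $L$ at $e$, then $z$ lies on $K$ with $ez=ex$, and unless $x$ lies on $L$, $B(x,e,z)$.
   Context: Logic is intuitionistic. Neutral constructive geometry means constructive plane geometry without any parallel postulate. Primitives: points, strict betweenness $B(a,b,c)$, segment congruence $ab=cd$; $T(a,b,c)$ abbreviates $\neg(a\neq b\wedge b\neq c\wedge\neg B(a,b,c))$. For $a\neq b$, a point $x$ lies on $\mathrm{Line}(a,b)$ iff $\neg\neg(B(a,b,x)\vee B(b,x,a)\vee B(x,a,b)\vee x=a\vee x=b)$; every line is given by two distinct points. Points are collinear if they lie on a common line. A circle is given by a center and a radius segment (possibly null). $ab\le cd$ means $\exists e\,(T(c,e,d)\wedge ab=ce)$. No particular axiomatization is prescribed; the principles used are: (1) Stability: $\neg\neg A\to A$ for $A$ an equality, betweenness or congruence. (2) $ab=ba$; $ab=pq\wedge ab=rs\to pq=rs$; $ab=cc\to a=b$. (3) Extension: if $a\neq b$ then for all $c,d$ there is $x$ with $T(a,b,x)$ and $bx=cd$. (4) Five-segment axiom: if $a\neq b$, $T(a,b,c)$, $T(a',b',c')$, $ab=a'b'$, $bc=b'c'$, $ad=a'd'$, $bd=b'd'$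 then $cd=c'd'$. (5) $B(a,b,c)$ implies $B(c,b,a)$, $a\ne b$, $b\neq c$; $\neg B(a,b,a)$; $T(a,b,d)\wedge T(b,c,d)\to T(a,b,c)\wedge T(a,c,d)$; $T(a,b,c)\wedge T(b,c,d)\wedge b\neq c\to T(a,c,d)\wedge T(a,b,d)$; $B(a,b,c)\wedge B(a,b,d)\wedge\neg T(a,c,d)\to T(a,d,c)$. (6) Inner Pasch: if $a,b,c$ are not collinear, $B(a,p,c)$ and $B(b,q,c)$, there is $x$ with $B(p,x,b)$ and $B(q,x,a)$. (7) There are three non-collinear points; any three points each equidistant from two given distinct points are collinear. (8) Line-circle continuity: if $a\ne b$, $a$ is non-strictly inside a circle and $b$ non-strictly outside it, then the circle contains a point $x$ with $T(a,x,b)$. Circle-circle continuity: if two circles have distinct centers and the first has a point non-strictly inside and a point non-strictly outside the second, they have a common point. Euclid 5: for all points $p,q,r,s,t,a$, if $B(q,a,r)$, $B(p,t,q)$, $B(s,t,r)$, $pt=qt$, $rt=st$, $p\neq r$, and $p$ is not on $\mathrm{Line}(s,q)$, then there is a point $x$ on both $\mathrm{Line}(s,q)$ and $\mathrm{Line}(p,a)$ with $B(p,a,x)$ and $B(s,q,x)$. Line $K$ is perpendicular to line $L$ at $m$ if $m$ is on both, and there are a point $a\neq m$ on $K$ and points $b,c$ on $L$ with $B(b,m,c)$, $ab=ac$ and $bm=mc$; $K$ is perpendicular to $L$ if this holds for some $m$. A term is a composition of the elementary ruler-and-compass constructions (line through two distinct points, circle with given center and radius, intersection points of two lines, of a line and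 a circle, and of two circles), starting from the given objects and three fixed non-collinear points; no case distinctions are allowed. The two intersection points of $\mathrm{Line}(a,b)$ with a circle are distinguished by their order on the line agreeing with that of $a,b$; the two intersection points of circles by handedness with respect to the centers. A term may be undefined when the required intersection does not exist. *)

theory Defs
  imports Main
begin

text \<open>
  The ambient logic of Isabelle/HOL is classical, and the theorem is about what can be proved in an
  intuitionistic theory about a syntactic term. Hence first-order intuitionistic logic is embedded
  deeply: points, formulas (with de Bruijn indices) and natural deduction. The only atomic terms of
  the logic are variables and the three fixed non-collinear points; ruler-and-compass terms,
  which may be undefined, are interpreted by the formula defining their graph.
\<close>

section \<open>Intuitionistic first-order logic\<close>

datatype fixed = Alpha | Beta | Gamma

datatype pt = Var nat | Fix fixed

text \<open>
  \<open>Bet\<close> is strict betweenness, \<open>Cong a b c d\<close> is congruence of the segments \<open>ab\<close> and \<open>cd\<close>, and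
  \<open>Lft a b c\<close> is handedness: \<open>c\<close> lies strictly to the left of the line directed from \<open>a\<close> to \<open>b\<close>.
\<close>

datatype fm =
    Falsum  ("\<^bold>\<bottom>")
  | Eq pt pt  (infix "\<^bold>=" 60)
  | Bet pt pt pt
  | Cong pt pt pt pt
  | Lft pt pt pt
  | And fm fm  (infixr "\<^bold>\<and>" 45)
  | Or fm fm  (infixr "\<^bold>\<or>" 40)
  | Imp fm fm  (infixr "\<^bold>\<longrightarrow>" 35)
  | Forall fm  ("\<^bold>\<forall> _" [50] 50)
  | Exists fm  ("\<^bold>\<exists> _" [50] 50)

abbreviation Neg :: "fm \<Rightarrow> fm"  ("\<^bold>\<not> _" [50] 50) where
  "\<^bold>\<not> A \<equiv> A \<^bold>\<longrightarrow> \<^bold>\<bottom>"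

abbreviation Neq :: "pt \<Rightarrow> pt \<Rightarrow> fm"  (infix "\<^bold>\<noteq>" 60) where
  "a \<^bold>\<noteq> b \<equiv> \<^bold>\<not> (a \<^bold>= b)"

text \<open>\<open>up k\<close> adapts a point of the surrounding context for use under \<open>k\<close> further quantifiers.\<close>

fun up :: "nat \<Rightarrow> pt \<Rightarrow> pt" where
  "up k (Var n) = Var (n + k)"
| "up k (Fix c) = Fix c"

fun sub_pt :: "(nat \<Rightarrow> pt) \<Rightarrow> pt \<Rightarrow> pt" where
  "sub_pt s (Var n) = s n"
| "sub_pt s (Fix c) = Fix c"

definition under :: "(nat \<Rightarrow> pt) \<Rightarrow> nat \<Rightarrow> pt" where
  "under s n = (case n of 0 \<Rightarrow> Var 0 | Suc m \<Rightarrow> up 1 (s m))"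

primrec sub :: "(nat \<Rightarrow> pt) \<Rightarrow> fm \<Rightarrow> fm" where
  "sub s \<^bold>\<bottom> = \<^bold>\<bottom>"
| "sub s (a \<^bold>= b) = (sub_pt s a \<^bold>= sub_pt s b)"
| "sub s (Bet a b c) = Bet (sub_pt s a) (sub_pt s b) (sub_pt s c)"
| "sub s (Cong a b c d) = Cong (sub_pt s a) (sub_pt s b) (sub_pt s c) (sub_pt s d)"
| "sub s (Lft a b c) = Lft (sub_pt s a) (sub_pt s b) (sub_pt s c)"
| "sub s (A \<^bold>\<and> B) = (sub s A \<^bold>\<and> sub s B)"
| "sub s (A \<^bold>\<or> B) = (sub s A \<^bold>\<or> sub s B)"
| "sub s (A \<^bold>\<longrightarrow> B) = (sub s A \<^bold>\<longrightarrow> sub s B)"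
| "sub s (\<^bold>\<forall> A) = (\<^bold>\<forall> (sub (under s) A))"
| "sub s (\<^bold>\<exists> A) = (\<^bold>\<exists> (sub (under s) A))"

definition lift :: "fm \<Rightarrow> fm" where
  "lift = sub (\<lambda>n. Var (Suc n))"

definition inst :: "pt \<Rightarrow> fm \<Rightarrow> fm" where
  "inst t = sub (\<lambda>n. case n of 0 \<Rightarrow> t | Suc m \<Rightarrow> Var m)"

text \<open>
  \<open>X; H \<turnstile> A\<close>: intuitionistic derivability of \<open>A\<close> from the axioms \<open>X\<close> and the hypotheses \<open>H\<close>.
  A free variable of a hypothesis denotes a fixed point, so the eigenvariable conditions of
  \<open>AllI\<close> and \<open>ExE\<close> apply to \<open>H\<close>; a free variable of an axiom is implicitly universally quantified.
\<close>

inductive derivable :: "fm set \<Rightarrow> fm set \<Rightarrow> fm \<Rightarrow> bool"  ("_; _ \<turnstile> _" [31, 31, 31] 30)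
  for X :: "fm set" where
  Axiom: "A \<in> X \<Longrightarrow> X; H \<turnstile> A"
| Hyp: "A \<in> H \<Longrightarrow> X; H \<turnstile> A"
| FalsumE: "X; H \<turnstile> \<^bold>\<bottom> \<Longrightarrow> X; H \<turnstile> A"
| AndI: "X; H \<turnstile> A \<Longrightarrow> X; H \<turnstile> B \<Longrightarrow> X; H \<turnstile> A \<^bold>\<and> B"
| AndE1: "X; H \<turnstile> A \<^bold>\<and> B \<Longrightarrow> X; H \<turnstile> A"
| AndE2: "X; H \<turnstile> A \<^bold>\<and> B \<Longrightarrow> X; H \<turnstile> B"
| OrI1: "X; H \<turnstile> A \<Longrightarrow> X; H \<turnstile> A \<^bold>\<or> B"
| OrI2: "X; H \<turnstile> B \<Longrightarrow> X; H \<turnstile> A \<^bold>\<or> B"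
| OrE: "X; H \<turnstile> A \<^bold>\<or> B \<Longrightarrow> X; insert A H \<turnstile> C \<Longrightarrow> X; insert B H \<turnstile> C \<Longrightarrow> X; H \<turnstile> C"
| ImpI: "X; insert A H \<turnstile> B \<Longrightarrow> X; H \<turnstile> A \<^bold>\<longrightarrow> B"
| ImpE: "X; H \<turnstile> A \<^bold>\<longrightarrow> B \<Longrightarrow> X; H \<turnstile> A \<Longrightarrow> X; H \<turnstile> B"
| AllI: "X; lift ` H \<turnstile> A \<Longrightarrow> X; H \<turnstile> \<^bold>\<forall> A"
| AllE: "X; H \<turnstile> \<^bold>\<forall> A \<Longrightarrow> X; H \<turnstile> inst t A"
| ExI: "X; H \<turnstile> inst t A \<Longrightarrow> X; H \<turnstile> \<^bold>\<exists> A"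
| ExE: "X; H \<turnstile> \<^bold>\<exists> A \<Longrightarrow> X; insert A (lift ` H) \<turnstile> lift C \<Longrightarrow> X; H \<turnstile> C"
| EqI: "X; H \<turnstile> t \<^bold>= t"
| EqE: "X; H \<turnstile> s \<^bold>= t \<Longrightarrow> X; H \<turnstile> inst s A \<Longrightarrow> X; H \<turnstile> inst t A"

section \<open>Geometric notions\<close>

definition T :: "pt \<Rightarrow> pt \<Rightarrow> pt \<Rightarrow> fm" where
  "T a b c = (\<^bold>\<not> (a \<^bold>\<noteq> b \<^bold>\<and> b \<^bold>\<noteq> c \<^bold>\<and> \<^bold>\<not> Bet a b c))"

text \<open>\<open>On x a b\<close>: the point \<open>x\<close> lies on \<open>Line(a,b)\<close>; it is only used where \<open>a \<noteq> b\<close>.\<close>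

definition On :: "pt \<Rightarrow> pt \<Rightarrow> pt \<Rightarrow> fm" where
  "On x a b = (\<^bold>\<not> \<^bold>\<not> (Bet a b x \<^bold>\<or> Bet b x a \<^bold>\<or> Bet x a b \<^bold>\<or> x \<^bold>= a \<^bold>\<or> x \<^bold>= b))"

definition Col :: "pt \<Rightarrow> pt \<Rightarrow> pt \<Rightarrow> fm" where
  "Col a b c = (\<^bold>\<exists> \<^bold>\<exists> (let a = up 2 a; b = up 2 b; c = up 2 c; p = Var 1; q = Var 0 in
     p \<^bold>\<noteq> q \<^bold>\<and> On a p q \<^bold>\<and> On b p q \<^bold>\<and> On c p q))"

definition Le :: "pt \<Rightarrow> pt \<Rightarrow> pt \<Rightarrow> pt \<Rightarrow> fm" where
  "Le a b c d = (\<^bold>\<exists> (let a = up 1 a; b = up 1 b; c = up 1 c; d = up 1 d; e = Var 0 in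
     T c e d \<^bold>\<and> Cong a b c e))"

text \<open>\<open>Perp k l a b\<close>: \<open>Line(k,l)\<close> is perpendicular to \<open>Line(a,b)\<close>.\<close>

definition Perp_at :: "pt \<Rightarrow> pt \<Rightarrow> pt \<Rightarrow> pt \<Rightarrow> pt \<Rightarrow> fm" where
  "Perp_at m k l a b = (On m k l \<^bold>\<and> On m a b \<^bold>\<and>
     (\<^bold>\<exists> \<^bold>\<exists> \<^bold>\<exists> (let m = up 3 m; k = up 3 k; l = up 3 l; a = up 3 a; b = up 3 b;
              p = Var 2; q = Var 1; r = Var 0 in
        p \<^bold>\<noteq> m \<^bold>\<and> On p k l \<^bold>\<and> On q a b \<^bold>\<and> On r a b \<^bold>\<and>
        Bet q m r \<^bold>\<and> Cong p q p r \<^bold>\<and> Cong q m m r)))"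

definition Perp :: "pt \<Rightarrow> pt \<Rightarrow> pt \<Rightarrow> pt \<Rightarrow> fm" where
  "Perp k l a b = (\<^bold>\<exists> (Perp_at (Var 0) (up 1 k) (up 1 l) (up 1 a) (up 1 b)))"

text \<open>
  For \<open>u\<close> and \<open>v\<close> on \<open>Line(a,b)\<close>, ordered such that \<open>a\<close> comes before \<open>b\<close>: \<open>u\<close> comes before \<open>v\<close> or
  coincides with it. The two clauses speak about \<open>u\<close> before \<open>b\<close> and \<open>u\<close> after \<open>a\<close>,
  which together cover (without deciding between them) all positions of \<open>u\<close>.
\<close>

definition Precedes :: "pt \<Rightarrow> pt \<Rightarrow> pt \<Rightarrow> pt \<Rightarrow> fm" where
  "Precedes a b u v =
     ((\<^bold>\<not> T a b u \<^bold>\<longrightarrow> \<^bold>\<not> Bet v u b) \<^bold>\<and> (\<^bold>\<not> T u a b \<^bold>\<longrightarrow> T a u v))"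

section \<open>Axioms\<close>

text \<open>
  The letters in the rules below range over all points of the logic, so that every axiom is
  present with all its instances.
\<close>

inductive_set neutral :: "fm set" where
  stable_eq: "(\<^bold>\<not> \<^bold>\<not> a \<^bold>= b \<^bold>\<longrightarrow> a \<^bold>= b) \<in> neutral"
| stable_bet: "(\<^bold>\<not> \<^bold>\<not> Bet a b c \<^bold>\<longrightarrow> Bet a b c) \<in> neutral"
| stable_cong: "(\<^bold>\<not> \<^bold>\<not> Cong a b c d \<^bold>\<longrightarrow> Cong a b c d) \<in> neutral"

| cong_swap: "Cong a b b a \<in> neutral"
| cong_trans: "(Cong a b p q \<^bold>\<and> Cong a b r s \<^bold>\<longrightarrow> Cong p q r s) \<in> neutral"
| cong_null: "(Cong a b c c \<^bold>\<longrightarrow> a \<^bold>= b) \<in> neutral"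

| extension: "(a \<^bold>\<noteq> b \<^bold>\<longrightarrow>
    \<^bold>\<exists> (let a = up 1 a; b = up 1 b; c = up 1 c; d = up 1 d; x = Var 0 in
       T a b x \<^bold>\<and> Cong b x c d)) \<in> neutral"

| five_segment: "(a \<^bold>\<noteq> b \<^bold>\<and> T a b c \<^bold>\<and> T a' b' c' \<^bold>\<and> Cong a b a' b' \<^bold>\<and> Cong b c b' c' \<^bold>\<and>
    Cong a d a' d' \<^bold>\<and> Cong b d b' d' \<^bold>\<longrightarrow> Cong c d c' d') \<in> neutral"

| bet_sym: "(Bet a b c \<^bold>\<longrightarrow> Bet c b a \<^bold>\<and> a \<^bold>\<noteq> b \<^bold>\<and> b \<^bold>\<noteq> c) \<in> neutral"
| bet_irrefl: "(\<^bold>\<not> Bet a b a) \<in> neutral"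
| inner_trans: "(T a b d \<^bold>\<and> T b c d \<^bold>\<longrightarrow> T a b c \<^bold>\<and> T a c d) \<in> neutral"
| outer_trans: "(T a b c \<^bold>\<and> T b c d \<^bold>\<and> b \<^bold>\<noteq> c \<^bold>\<longrightarrow> T a c d \<^bold>\<and> T a b d) \<in> neutral"
| bet_connect: "(Bet a b c \<^bold>\<and> Bet a b d \<^bold>\<and> \<^bold>\<not> T a c d \<^bold>\<longrightarrow> T a d c) \<in> neutral"

| inner_Pasch: "(\<^bold>\<not> Col a b c \<^bold>\<and> Bet a p c \<^bold>\<and> Bet b q c \<^bold>\<longrightarrow>
    \<^bold>\<exists> (let a = up 1 a; b = up 1 b; p = up 1 p; q = up 1 q; x = Var 0 in
       Bet p x b \<^bold>\<and> Bet q x a)) \<in> neutral"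

| lower_dim: "(\<^bold>\<not> Col (Fix Alpha) (Fix Beta) (Fix Gamma)) \<in> neutral"
| upper_dim: "(p \<^bold>\<noteq> q \<^bold>\<and> Cong a p a q \<^bold>\<and> Cong b p b q \<^bold>\<and> Cong c p c q \<^bold>\<longrightarrow> Col a b c) \<in> neutral"

| line_circle: "(a \<^bold>\<noteq> b \<^bold>\<and> Le c a p q \<^bold>\<and> Le p q c b \<^bold>\<longrightarrow>
    \<^bold>\<exists> (let a = up 1 a; b = up 1 b; c = up 1 c; p = up 1 p; q = up 1 q; x = Var 0 in
       Cong c x p q \<^bold>\<and> T a x b)) \<in> neutral"
| circle_circle: "(c \<^bold>\<noteq> d \<^bold>\<and> Cong c u p q \<^bold>\<and> Cong c v p q \<^bold>\<and> Le d u r s \<^bold>\<and> Le r s d v \<^bold>\<longrightarrow>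
    \<^bold>\<exists> (let c = up 1 c; d = up 1 d; p = up 1 p; q = up 1 q; r = up 1 r; s = up 1 s; x = Var 0 in
       Cong c x p q \<^bold>\<and> Cong d x r s)) \<in> neutral"

inductive_set euclid5 :: "fm set" where
  "(Bet q a r \<^bold>\<and> Bet p t q \<^bold>\<and> Bet s t r \<^bold>\<and> Cong p t q t \<^bold>\<and> Cong r t s t \<^bold>\<and>
    p \<^bold>\<noteq> r \<^bold>\<and> \<^bold>\<not> On p s q \<^bold>\<longrightarrow>
    \<^bold>\<exists> (let p = up 1 p; a = up 1 a; s = up 1 s; q = up 1 q; x = Var 0 in
       On x s q \<^bold>\<and> On x p a \<^bold>\<and> Bet p a x \<^bold>\<and> Bet s q x)) \<in> euclid5"

text \<open>
  Handedness only serves to give a meaning to the two circle-circle constructions. The axioms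
  up to \<open>left_opposite_side\<close> determine \<open>Lft\<close>: it is the orientation of the plane
  for which \<open>(\<alpha>,\<beta>,\<gamma>)\<close> is a left turn. The last two say that both circle-circle constructions
  are defined as soon as the circles (with distinct centers) have a common point.
  A point to the right of the directed line \<open>cd\<close> is one to the left of \<open>dc\<close>.
\<close>

inductive_set handedness :: "fm set" where
  stable_left: "(\<^bold>\<not> \<^bold>\<not> Lft a b c \<^bold>\<longrightarrow> Lft a b c) \<in> handedness"
| left_fixed: "Lft (Fix Alpha) (Fix Beta) (Fix Gamma) \<in> handedness"
| left_off_line: "(Lft a b c \<^bold>\<longrightarrow> a \<^bold>\<noteq> b \<^bold>\<and> \<^bold>\<not> On c a b) \<in> handedness"
| left_asym: "(Lft a b c \<^bold>\<longrightarrow> \<^bold>\<not> Lft b a c) \<in> handedness"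
| left_total: "(a \<^bold>\<noteq> b \<^bold>\<and> \<^bold>\<not> On c a b \<^bold>\<and> \<^bold>\<not> Lft a b c \<^bold>\<longrightarrow> Lft b a c) \<in> handedness"
| left_cyclic: "(Lft a b c \<^bold>\<longrightarrow> Lft b c a) \<in> handedness"
| left_same_side: "(Lft a b c \<^bold>\<and> \<^bold>\<not> On d a b \<^bold>\<and>
    \<^bold>\<not> (\<^bold>\<exists> (let a = up 1 a; b = up 1 b; c = up 1 c; d = up 1 d; p = Var 0 in
         On p a b \<^bold>\<and> Bet c p d)) \<^bold>\<longrightarrow> Lft a b d) \<in> handedness"
| left_opposite_side: "(Lft a b c \<^bold>\<and> On p a b \<^bold>\<and> Bet c p d \<^bold>\<longrightarrow> Lft b a d) \<in> handedness"
| left_intersection: "(c \<^bold>\<noteq> d \<^bold>\<and> Cong c x p q \<^bold>\<and> Cong d x r s \<^bold>\<longrightarrow>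
    \<^bold>\<exists> (let c = up 1 c; d = up 1 d; p = up 1 p; q = up 1 q; r = up 1 r; s = up 1 s; z = Var 0 in
       Cong c z p q \<^bold>\<and> Cong d z r s \<^bold>\<and> \<^bold>\<not> Lft d c z)) \<in> handedness"
| right_intersection: "(c \<^bold>\<noteq> d \<^bold>\<and> Cong c x p q \<^bold>\<and> Cong d x r s \<^bold>\<longrightarrow>
    \<^bold>\<exists> (let c = up 1 c; d = up 1 d; p = up 1 p; q = up 1 q; r = up 1 r; s = up 1 s; z = Var 0 in
       Cong c z p q \<^bold>\<and> Cong d z r s \<^bold>\<and> \<^bold>\<not> Lft c d z)) \<in> handedness"

section \<open>Ruler-and-compass terms\<close>

text \<open>
  Terms denoting points, lines and circles, built from given points indexed by \<open>'v\<close> and the three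
  fixed points. \<open>Circle t u v\<close> has center \<open>t\<close> and radius segment \<open>uv\<close>.
\<close>

datatype 'v tm =
    Given 'v
  | Const fixed
  | LineLine "'v ln" "'v ln"
  | LineCirc1 "'v ln" "'v ci"
  | LineCirc2 "'v ln" "'v ci"
  | CircCirc1 "'v ci" "'v ci"
  | CircCirc2 "'v ci" "'v ci"
and 'v ln = Line "'v tm" "'v tm"
and 'v ci = Circle "'v tm" "'v tm" "'v tm"

text \<open>
  \<open>Val g t z\<close>: the term \<open>t\<close> is defined and has the value \<open>z\<close>, where \<open>g\<close> assigns points of the logic to
  the given points. \<open>LnVal\<close> and \<open>CiVal\<close> do the same for the points that give a line or circle.
  A line requires distinct points; two lines intersect only if they do not coincide; two circles
  intersect only if their centers are distinct. \<open>LineCirc1\<close> and \<open>LineCirc2\<close> are the first and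
  the last of all intersection points, in the order of the line.
  \<open>CircCirc1\<close> is not to the right, and \<open>CircCirc2\<close> not to the left, of the line from the first
  center to the second. The two points coincide in case of tangency.
\<close>

primrec Val :: "('v \<Rightarrow> pt) \<Rightarrow> 'v tm \<Rightarrow> pt \<Rightarrow> fm"
  and LnVal :: "('v \<Rightarrow> pt) \<Rightarrow> 'v ln \<Rightarrow> pt \<Rightarrow> pt \<Rightarrow> fm"
  and CiVal :: "('v \<Rightarrow> pt) \<Rightarrow> 'v ci \<Rightarrow> pt \<Rightarrow> pt \<Rightarrow> pt \<Rightarrow> fm"
  where
  "Val g (Given v) z = (z \<^bold>= g v)"
| "Val g (Const c) z = (z \<^bold>= Fix c)"
| "Val g (LineLine k l) z = (\<^bold>\<exists> \<^bold>\<exists> \<^bold>\<exists> \<^bold>\<exists> (let a = Var 3; b = Var 2; c = Var 1; d = Var 0; z = up 4 z in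
     LnVal (up 4 \<circ> g) k a b \<^bold>\<and> LnVal (up 4 \<circ> g) l c d \<^bold>\<and>
     \<^bold>\<not> (On a c d \<^bold>\<and> On b c d) \<^bold>\<and> On z a b \<^bold>\<and> On z c d))"
| "Val g (LineCirc1 k o1) z = (\<^bold>\<exists> \<^bold>\<exists> \<^bold>\<exists> \<^bold>\<exists> \<^bold>\<exists>
     (let a = Var 4; b = Var 3; c = Var 2; p = Var 1; q = Var 0; z = up 5 z in
     LnVal (up 5 \<circ> g) k a b \<^bold>\<and> CiVal (up 5 \<circ> g) o1 c p q \<^bold>\<and> On z a b \<^bold>\<and> Cong c z p q \<^bold>\<and>
     (\<^bold>\<forall> (let a = up 1 a; b = up 1 b; c = up 1 c; p = up 1 p; q = up 1 q; z = up 1 z; w = Var 0 in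
        On w a b \<^bold>\<and> Cong c w p q \<^bold>\<longrightarrow> Precedes a b z w))))"
| "Val g (LineCirc2 k o1) z = (\<^bold>\<exists> \<^bold>\<exists> \<^bold>\<exists> \<^bold>\<exists> \<^bold>\<exists>
     (let a = Var 4; b = Var 3; c = Var 2; p = Var 1; q = Var 0; z = up 5 z in
     LnVal (up 5 \<circ> g) k a b \<^bold>\<and> CiVal (up 5 \<circ> g) o1 c p q \<^bold>\<and> On z a b \<^bold>\<and> Cong c z p q \<^bold>\<and>
     (\<^bold>\<forall> (let a = up 1 a; b = up 1 b; c = up 1 c; p = up 1 p; q = up 1 q; z = up 1 z; w = Var 0 in
        On w a b \<^bold>\<and> Cong c w p q \<^bold>\<longrightarrow> Precedes a b w z))))"
| "Val g (CircCirc1 o1 o2) z = (\<^bold>\<exists> \<^bold>\<exists> \<^bold>\<exists> \<^bold>\<exists> \<^bold>\<exists> \<^bold>\<exists>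
     (let c = Var 5; p = Var 4; q = Var 3; d = Var 2; r = Var 1; s = Var 0; z = up 6 z in
     CiVal (up 6 \<circ> g) o1 c p q \<^bold>\<and> CiVal (up 6 \<circ> g) o2 d r s \<^bold>\<and> c \<^bold>\<noteq> d \<^bold>\<and>
     Cong c z p q \<^bold>\<and> Cong d z r s \<^bold>\<and> \<^bold>\<not> Lft d c z))"
| "Val g (CircCirc2 o1 o2) z = (\<^bold>\<exists> \<^bold>\<exists> \<^bold>\<exists> \<^bold>\<exists> \<^bold>\<exists> \<^bold>\<exists>
     (let c = Var 5; p = Var 4; q = Var 3; d = Var 2; r = Var 1; s = Var 0; z = up 6 z in
     CiVal (up 6 \<circ> g) o1 c p q \<^bold>\<and> CiVal (up 6 \<circ> g) o2 d r s \<^bold>\<and> c \<^bold>\<noteq> d \<^bold>\<and>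
     Cong c z p q \<^bold>\<and> Cong d z r s \<^bold>\<and> \<^bold>\<not> Lft c d z))"
| "LnVal g (Line t u) a b = (Val g t a \<^bold>\<and> Val g u b \<^bold>\<and> a \<^bold>\<noteq> b)"
| "CiVal g (Circle t u v) c p q = (Val g t c \<^bold>\<and> Val g u p \<^bold>\<and> Val g v q)"

definition Defined :: "('v \<Rightarrow> pt) \<Rightarrow> 'v tm \<Rightarrow> fm" where
  "Defined g t = (\<^bold>\<exists> (Val (up 1 \<circ> g) t (Var 0)))"

text \<open>
  The given objects of a construction from a point \<open>x\<close> and a line \<open>L\<close>; the line is
  given by two points.
\<close>

datatype given = Point | LinePoint1 | LinePoint2

primrec point_and_line :: "pt \<Rightarrow> pt \<Rightarrow> pt \<Rightarrow> given \<Rightarrow> pt" where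
  "point_and_line x a b Point = x"
| "point_and_line x a b LinePoint1 = a"
| "point_and_line x a b LinePoint2 = b"

end

theory Submission
  imports Defs "HOL-Library.Countable_Set"
begin

text \<open>
  The proof combines a geometric and a logical idea.

  Geometry. Let \<open>Q\<close> be a perpendicular to the line \<open>L\<close>, meeting it in \<open>m\<close>. The reflection in \<open>L\<close> is the reflection
  in \<open>Q\<close> followed by the reflection in the point \<open>m\<close>. The advantage is that \<open>Q\<close> can be adapted to \<open>x\<close>: if \<open>L\<close> is
  given by \<open>a\<close> and \<open>b\<close>, then \<open>m\<close> is chosen on \<open>L\<close> farther from \<open>a\<close> than \<open>x\<close> is. As a leg of a right triangle is
  shorter than the hypotenuse (\<open>leg_less_hypotenuse\<close>), \<open>x\<close> then lies strictly on the side of \<open>Q\<close> that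
  contains \<open>a\<close>, wherever it is with respect to \<open>L\<close> (\<open>x_side\<close>). Hence, for two points \<open>q\<close> and \<open>q'\<close> of \<open>Q\<close>, the
  circles about \<open>q\<close> and \<open>q'\<close> through \<open>x\<close> have a second intersection \<open>y\<close> on the other side of \<open>Q\<close>, which handedness
  singles out. It is off \<open>Q\<close>, so it differs from \<open>m\<close> and spans a line with it, and prolonging \<open>ym\<close> by itself gives
  the result. That this composition is the reflection in \<open>L\<close> follows from the facts that point and line
  reflections are isometries (\<open>reflect_isometry\<close>, \<open>line_reflection_isometry\<close>) and that perpendiculars are unique
  (\<open>right_unique\<close>); see \<open>value_is_mirror_image\<close>.

  Logic. All atomic formulas are stable, and so is every formula without \<open>\<or>\<close> and \<open>\<exists>\<close> in its conclusion. Such a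
  formula is intuitionistically derivable as soon as it holds in all classical models of the axioms
  (\<open>derivable_if_valid\<close>). This is proved by Henkin's method: a maximal consistent set of formulas behaves
  classically even if consistency refers to intuitionistic logic, provided that only stable formulas are
  universally quantified. The correctness of the construction is stable; thus it is enough to prove it by
  classical reasoning in the locale \<open>geometry\<close>. Definedness is an existential statement and is derived in the
  calculus, one new point after the other (\<open>reflection_defined\<close>). Each point exists by an axiom
  whose premises, such as the distinctness of two points, again follow from classical validity.
\<close>


section \<open>Substitution\<close>

lemma up_simps [simp]: "sub_pt (under s) (up 1 p) = up 1 (sub_pt s p)"
  by (cases p) (auto simp: under_def)

lemma up_up [simp]: "up m (up n p) = up (n + m) p"
  by (cases p) auto

lemma up_0 [simp]: "up 0 p = p"
  by (cases p) auto

lemma up_under_Suc [simp]: "sub_pt (under s) (up (Suc n) p) = up 1 (sub_pt s (up n p))"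
  by (cases p) (auto simp: under_def)

lemma under_0 [simp]: "under s 0 = Var 0" by (simp add: under_def)
lemma under_Suc [simp]: "under s (Suc n) = up 1 (s n)" by (simp add: under_def)
lemma under_numeral [simp]: "under s (numeral k) = up 1 (s (pred_numeral k))"
  by (simp add: numeral_eq_Suc)
lemma up_under_numeral [simp]: "sub_pt (under s) (up (numeral k) p) = up 1 (sub_pt s (up (pred_numeral k) p))"
  by (simp add: numeral_eq_Suc)

lemma sub_pt_sub_pt: "sub_pt s (sub_pt r p) = sub_pt (\<lambda>n. sub_pt s (r n)) p"
  by (cases p) auto

lemma under_under: "(\<lambda>n. sub_pt (under s) (under r n)) = under (\<lambda>n. sub_pt s (r n))"
  by (auto simp: fun_eq_iff under_def split: nat.split)

lemma sub_sub: "sub s (sub r A) = sub (\<lambda>n. sub_pt s (r n)) A"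
  by (induction A arbitrary: s r) (auto simp: sub_pt_sub_pt under_under)

lemma sub_pt_Var: "sub_pt Var p = p" by (cases p) auto

lemma under_Var: "under Var = Var"
  by (auto simp: fun_eq_iff under_def split: nat.split)

lemma sub_Var: "sub Var A = A"
  by (induction A) (auto simp: sub_pt_Var under_Var)

lemma sub_under_lift: "sub (under s) (lift A) = lift (sub s A)"
proof -
  have "up 1 p = sub_pt (\<lambda>n. Var (Suc n)) p" for p by (cases p) auto
  then show ?thesis by (simp add: lift_def sub_sub)
qed

lemma sub_inst: "sub s (inst t A) = inst (sub_pt s t) (sub (under s) A)"
proof -
  have "sub_pt (\<lambda>n. case n of 0 \<Rightarrow> t | Suc m \<Rightarrow> Var m) (up 1 p) = p" for t p by (cases p) auto
  then show ?thesis
    by (auto simp: inst_def sub_sub under_def intro!: arg_cong[where f = "\<lambda>r. sub r A"] split: nat.split)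
qed

lemma inst_sub_under: "inst t (sub (under s) A) = sub (case_nat t s) A"
proof -
  have "sub_pt (\<lambda>n. case n of 0 \<Rightarrow> t | Suc m \<Rightarrow> Var m) (up 1 p) = p" for p by (cases p) auto
  then show ?thesis
    by (auto simp: inst_def sub_sub under_def intro!: arg_cong[where f = "\<lambda>r. sub r A"] split: nat.split)
qed

lemma inst_Var_0_lifted: "inst (Var 0) (sub (under (\<lambda>n. Var (Suc n))) A) = A"
proof -
  have "case_nat (Var 0) (\<lambda>n. Var (Suc n)) = Var" by (auto simp: fun_eq_iff split: nat.split)
  then show ?thesis by (simp add: inst_sub_under sub_Var)
qed

definition substitution_closed :: "fm set \<Rightarrow> bool" where
  "substitution_closed X \<longleftrightarrow> (\<forall>A \<in> X. \<forall>s. sub s A \<in> X)"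

text \<open>
  The eigenvariable conditions are no obstacle: in \<open>AllI\<close> and \<open>ExE\<close> the lifted hypotheses and the
  formula under the quantifier are treated by the same substitution \<open>under s\<close>.
\<close>
lemma derivable_sub:
  assumes "X; H \<turnstile> A" "substitution_closed X"
  shows "X; sub s ` H \<turnstile> sub s A"
  using assms(1)
proof (induction arbitrary: s rule: derivable.induct)
  case (Axiom A H)
  then show ?case using assms(2) by (auto simp: substitution_closed_def intro: derivable.Axiom)
next
  case (OrE H A B C)
  then show ?case by (simp, metis derivable.OrE)
next
  case (AllI H A)
  from AllI.IH[of "under s"] show ?case
    by (auto simp: image_image sub_under_lift intro!: derivable.AllI)
next
  case (AllE H A t)
  then show ?case by (simp add: sub_inst derivable.AllE)
next
  case (ExI H t A)
  then show ?case by (auto simp: sub_inst intro: derivable.ExI)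
next
  case (ExE H A C)
  from ExE.IH(1)[of s] ExE.IH(2)[of "under s"] show ?case
    by (auto simp: image_image sub_under_lift intro: derivable.ExE)
next
  case (EqE H p t A)
  then show ?case by (simp add: sub_inst) (metis derivable.EqE)
qed (auto intro: derivable.intros)

section \<open>Derived rules\<close>

lemma weaken: "X; H \<turnstile> A \<Longrightarrow> H \<subseteq> H' \<Longrightarrow> X; H' \<turnstile> A"
proof (induction arbitrary: H' rule: derivable.induct)
  case (OrE H A B C)
  then show ?case by (meson derivable.OrE insert_mono)
next
  case (ImpI A H B)
  then show ?case by (meson derivable.ImpI insert_mono)
next
  case (AllI H A)
  then show ?case by (meson derivable.AllI image_mono)
next
  case (ExE H A C)
  then show ?case by (meson derivable.ExE image_mono insert_mono)
next
  case (EqE H s t A)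
  then show ?case by (meson derivable.EqE)
qed (auto intro: derivable.intros)

lemma derivable_mono: "X; H \<turnstile> A \<Longrightarrow> X \<subseteq> Y \<Longrightarrow> Y; H \<turnstile> A"
  by (induction rule: derivable.induct) (auto intro: derivable.intros)

lemma cut: "X; H \<turnstile> A \<Longrightarrow> X; insert A H \<turnstile> B \<Longrightarrow> X; H \<turnstile> B"
  by (meson ImpE ImpI)

lemma cut_set: "finite G \<Longrightarrow> X; G \<turnstile> B \<Longrightarrow> (\<And>A. A \<in> G \<Longrightarrow> X; H \<turnstile> A) \<Longrightarrow> X; H \<turnstile> B"
proof (induction G arbitrary: B rule: finite_induct)
  case empty
  then show ?case by (auto intro: weaken)
next
  case (insert A G)
  then have "X; G \<turnstile> A \<^bold>\<longrightarrow> B" by (auto intro: ImpI)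
  with insert show ?case by (meson ImpE insertCI)
qed

text \<open>
  All free variables are below \<open>k\<close>, put semantically: this is easy to check for the defined geometric
  notions, whose quantified variables need not be looked at.
\<close>
definition bounded :: "nat \<Rightarrow> fm \<Rightarrow> bool" where
  "bounded k A \<longleftrightarrow> (\<forall>s r. (\<forall>n<k. s n = r n) \<longrightarrow> sub s A = sub r A)"

lemma bounded_mono: "bounded k A \<Longrightarrow> k \<le> l \<Longrightarrow> bounded l A"
  by (auto simp: bounded_def)

lemma boundedD: "bounded k A \<Longrightarrow> (\<And>n. n < k \<Longrightarrow> s n = r n) \<Longrightarrow> sub s A = sub r A"
  by (auto simp: bounded_def)

lemma bounded_binder:
  assumes "bounded k A" "\<forall>n<k. s n = r n"
  shows "sub (under s) A = sub (under r) A"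
  using assms(2) by (intro boundedD[OF assms(1)]) (auto simp: under_def split: nat.split)

primrec pt_bound :: "pt \<Rightarrow> nat" where
  "pt_bound (Var n) = Suc n"
| "pt_bound (Fix c) = 0"

primrec var_bound :: "fm \<Rightarrow> nat" where
  "var_bound \<^bold>\<bottom> = 0"
| "var_bound (a \<^bold>= b) = pt_bound a + pt_bound b"
| "var_bound (Bet a b c) = pt_bound a + pt_bound b + pt_bound c"
| "var_bound (Cong a b c d) = pt_bound a + pt_bound b + pt_bound c + pt_bound d"
| "var_bound (Lft a b c) = pt_bound a + pt_bound b + pt_bound c"
| "var_bound (A \<^bold>\<and> B) = var_bound A + var_bound B"
| "var_bound (A \<^bold>\<or> B) = var_bound A + var_bound B"
| "var_bound (A \<^bold>\<longrightarrow> B) = var_bound A + var_bound B"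
| "var_bound (\<^bold>\<forall> A) = var_bound A"
| "var_bound (\<^bold>\<exists> A) = var_bound A"

lemma sub_pt_cong: "pt_bound p \<le> k \<Longrightarrow> \<forall>n<k. s n = r n \<Longrightarrow> sub_pt s p = sub_pt r p"
  by (cases p) auto

lemma bounded_var_bound: "var_bound A \<le> k \<Longrightarrow> bounded k A"
proof (induction A)
  case (Forall A)
  then show ?case using bounded_binder by (auto simp: bounded_def)
next
  case (Exists A)
  then show ?case using bounded_binder by (auto simp: bounded_def)
qed (auto simp: bounded_def intro: sub_pt_cong)

lemma ex_bounded_set:
  assumes "finite H" shows "\<exists>k. \<forall>A\<in>H. bounded k A"
proof -
  have "\<forall>A\<in>H. bounded (\<Sum>A\<in>H. var_bound A) A"
    by (metis assms bounded_var_bound member_le_sum zero_le)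
  then show ?thesis ..
qed

text \<open>
  Existential elimination with a fresh variable \<open>Var k\<close> and an unchanged context. Renaming \<open>Var k\<close> to
  \<open>Var 0\<close> and every \<open>Var n\<close> below to \<open>Var (Suc n)\<close> turns the last premise into that of \<open>ExE\<close>.
\<close>
lemma exE_fresh:
  assumes X: "substitution_closed X" and ex: "X; H \<turnstile> \<^bold>\<exists> A"
    and bd: "\<And>B. B \<in> H \<Longrightarrow> bounded k B" "bounded (Suc k) A" "bounded k C"
    and C: "X; insert (inst (Var k) A) H \<turnstile> C"
  shows "X; H \<turnstile> C"
proof -
  define s where "s n = (if n < k then Var (Suc n) else Var 0)" for n
  have lift: "sub s B = lift B" if "bounded k B" for B
    unfolding lift_def by (rule boundedD[OF that]) (simp add: s_def)
  \<comment> \<open>\<open>s\<close> undoes the choice of \<open>Var k\<close>: it is the identity on the remaining variables of \<open>A\<close>.\<close>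
  have "sub s (inst (Var k) A) = sub Var A"
    unfolding inst_def sub_sub
    by (rule boundedD[OF bd(2)]) (auto simp: s_def split: nat.split)
  then have A: "sub s (inst (Var k) A) = A" by (simp add: sub_Var)
  have "sub s ` H = lift ` H" using bd(1) lift by auto
  then have "X; insert A (lift ` H) \<turnstile> lift C"
    using derivable_sub[OF C X, of s] by (simp add: A lift bd(3))
  with ex show ?thesis by (rule ExE)
qed

section \<open>Stable formulas\<close>

text \<open>
  Formulas whose conclusions involve neither \<open>\<or>\<close> nor \<open>\<exists>\<close>. As atoms are stable, so are these
  (lemma \<open>stable_fm_dn_elim\<close>).
\<close>
primrec stable_fm :: "fm \<Rightarrow> bool" where
  "stable_fm \<^bold>\<bottom> = True"
| "stable_fm (a \<^bold>= b) = True"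
| "stable_fm (Bet a b c) = True"
| "stable_fm (Cong a b c d) = True"
| "stable_fm (Lft a b c) = True"
| "stable_fm (A \<^bold>\<and> B) = (stable_fm A \<and> stable_fm B)"
| "stable_fm (A \<^bold>\<or> B) = False"
| "stable_fm (A \<^bold>\<longrightarrow> B) = stable_fm B"
| "stable_fm (\<^bold>\<forall> A) = stable_fm A"
| "stable_fm (\<^bold>\<exists> A) = False"

text \<open>
  Up to double negation, the laws of classical logic hold intuitionistically, with one exception:
  \<open>\<not>(\<forall>x. A)\<close> is compatible with \<open>\<not>(\<exists>x. \<not>A)\<close>. It is not if \<open>A\<close> is stable.
\<close>
primrec stable_foralls :: "fm \<Rightarrow> bool" where
  "stable_foralls \<^bold>\<bottom> = True"
| "stable_foralls (a \<^bold>= b) = True"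
| "stable_foralls (Bet a b c) = True"
| "stable_foralls (Cong a b c d) = True"
| "stable_foralls (Lft a b c) = True"
| "stable_foralls (A \<^bold>\<and> B) = (stable_foralls A \<and> stable_foralls B)"
| "stable_foralls (A \<^bold>\<or> B) = (stable_foralls A \<and> stable_foralls B)"
| "stable_foralls (A \<^bold>\<longrightarrow> B) = (stable_foralls A \<and> stable_foralls B)"
| "stable_foralls (\<^bold>\<forall> A) = (stable_foralls A \<and> stable_fm A)"
| "stable_foralls (\<^bold>\<exists> A) = stable_foralls A"

lemma stable_fm_sub [simp]: "stable_fm (sub s A) = stable_fm A"
  by (induction A arbitrary: s) auto

lemma stable_foralls_sub [simp]: "stable_foralls (sub s A) = stable_foralls A"
  by (induction A arbitrary: s) auto

definition has_stability :: "fm set \<Rightarrow> bool" where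
  "has_stability X \<longleftrightarrow> (\<forall>a b. (\<^bold>\<not> \<^bold>\<not> a \<^bold>= b \<^bold>\<longrightarrow> a \<^bold>= b) \<in> X) \<and>
     (\<forall>a b c. (\<^bold>\<not> \<^bold>\<not> Bet a b c \<^bold>\<longrightarrow> Bet a b c) \<in> X) \<and>
     (\<forall>a b c d. (\<^bold>\<not> \<^bold>\<not> Cong a b c d \<^bold>\<longrightarrow> Cong a b c d) \<in> X) \<and>
     (\<forall>a b c. (\<^bold>\<not> \<^bold>\<not> Lft a b c \<^bold>\<longrightarrow> Lft a b c) \<in> X)"

lemma ImpE_axiom: "(A \<^bold>\<longrightarrow> B) \<in> X \<Longrightarrow> X; H \<turnstile> A \<Longrightarrow> X; H \<turnstile> B"
  by (meson Axiom ImpE)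

lemma dn_map: "X; insert A H \<turnstile> B \<Longrightarrow> X; H \<turnstile> \<^bold>\<not> \<^bold>\<not> A \<Longrightarrow> X; H \<turnstile> \<^bold>\<not> \<^bold>\<not> B"
proof -
  assume B: "X; insert A H \<turnstile> B" and A: "X; H \<turnstile> \<^bold>\<not> \<^bold>\<not> A"
  have "X; insert A (insert (\<^bold>\<not> B) H) \<turnstile> \<^bold>\<bottom>"
    by (rule ImpE[OF Hyp[where A = "\<^bold>\<not> B"]]) (auto intro: weaken[OF B])
  then have "X; insert (\<^bold>\<not> B) H \<turnstile> \<^bold>\<not> A" by (rule ImpI)
  moreover have "X; insert (\<^bold>\<not> B) H \<turnstile> \<^bold>\<not> \<^bold>\<not> A" by (auto intro: weaken[OF A])
  ultimately show ?thesis by (meson ImpE ImpI)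
qed

lemma lift_hyps: "substitution_closed X \<Longrightarrow> X; H \<turnstile> A \<Longrightarrow> X; lift ` H \<turnstile> lift A"
  unfolding lift_def by (rule derivable_sub)

lemma lift_Forall_E: "X; insert (lift (\<^bold>\<forall> A)) H \<turnstile> A"
proof -
  have "X; insert (lift (\<^bold>\<forall> A)) H \<turnstile> \<^bold>\<forall> (sub (under (\<lambda>n. Var (Suc n))) A)"
    by (rule Hyp) (simp add: lift_def)
  from AllE[OF this, of "Var 0"] show ?thesis by (simp only: inst_Var_0_lifted)
qed

lemma stable_fm_dn_elim:
  assumes X: "substitution_closed X" "has_stability X"
  shows "stable_fm A \<Longrightarrow> X; H \<turnstile> \<^bold>\<not> \<^bold>\<not> A \<Longrightarrow> X; H \<turnstile> A"
proof (induction A arbitrary: H)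
  case Falsum
  then show ?case by (meson Hyp ImpE ImpI insertI1)
next
  case (And A B)
  have "X; H \<turnstile> \<^bold>\<not> \<^bold>\<not> A" "X; H \<turnstile> \<^bold>\<not> \<^bold>\<not> B"
    by (rule dn_map[OF _ And.prems(2)], meson AndE1 AndE2 Hyp insertI1)+
  with And show ?case by (auto intro: AndI)
next
  case (Imp A B)
  have "X; insert (A \<^bold>\<longrightarrow> B) (insert A H) \<turnstile> B" by (meson Hyp ImpE insertI1 insertI2)
  moreover have "X; insert A H \<turnstile> \<^bold>\<not> \<^bold>\<not> (A \<^bold>\<longrightarrow> B)" by (auto intro: weaken[OF Imp.prems(2)])
  ultimately have "X; insert A H \<turnstile> \<^bold>\<not> \<^bold>\<not> B" by (rule dn_map)
  with Imp show ?case by (auto intro: ImpI)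
next
  case (Forall A)
  have "X; lift ` H \<turnstile> \<^bold>\<not> \<^bold>\<not> lift (\<^bold>\<forall> A)"
    using lift_hyps[OF X(1) Forall.prems(2)] by (simp add: lift_def)
  then have "X; lift ` H \<turnstile> \<^bold>\<not> \<^bold>\<not> A" by (rule dn_map[OF lift_Forall_E])
  with Forall show ?case by (auto intro: AllI)
next
  case (Eq a b)
  show ?case by (rule ImpE_axiom[OF _ Eq.prems(2)]) (use X(2) in \<open>simp add: has_stability_def\<close>)
next
  case (Bet a b c)
  show ?case by (rule ImpE_axiom[OF _ Bet.prems(2)]) (use X(2) in \<open>simp add: has_stability_def\<close>)
next
  case (Cong a b c d)
  show ?case by (rule ImpE_axiom[OF _ Cong.prems(2)]) (use X(2) in \<open>simp add: has_stability_def\<close>)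
next
  case (Lft a b c)
  show ?case by (rule ImpE_axiom[OF _ Lft.prems(2)]) (use X(2) in \<open>simp add: has_stability_def\<close>)
qed simp_all

text \<open>
  The instance of classical reasoning about quantifiers on which the truth lemma for \<open>\<forall>\<close> rests.
\<close>
lemma not_ex_not:
  assumes X: "substitution_closed X" "has_stability X" and "stable_fm A"
  shows "X; {\<^bold>\<not> (\<^bold>\<exists> (\<^bold>\<not> A))} \<turnstile> \<^bold>\<forall> A"
proof -
  let ?N = "lift (\<^bold>\<not> (\<^bold>\<exists> (\<^bold>\<not> A)))"
  \<comment> \<open>After lifting, the witness for the existential is the new variable itself.\<close>
  have "X; {\<^bold>\<not> A, ?N} \<turnstile> \<^bold>\<exists> (\<^bold>\<not> sub (under (\<lambda>n. Var (Suc n))) A)"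
    using inst_Var_0_lifted[of A]
    by (intro ExI[where t = "Var 0"] Hyp) (simp add: inst_def)
  moreover have "X; {\<^bold>\<not> A, ?N} \<turnstile> \<^bold>\<not> (\<^bold>\<exists> (\<^bold>\<not> sub (under (\<lambda>n. Var (Suc n))) A))"
    by (rule Hyp) (simp add: lift_def)
  ultimately have "X; {?N} \<turnstile> \<^bold>\<not> \<^bold>\<not> A" by (meson ImpE ImpI)
  then have "X; {?N} \<turnstile> A" using stable_fm_dn_elim[OF X assms(3)] by blast
  then show ?thesis by (intro AllI) simp
qed

section \<open>Complete intuitionistic theories\<close>

text \<open>
  One stage of Lindenbaum's construction. A formula that cannot be added consistently is refuted, and its
  negation is then derivable by implication introduction; so maximal consistent sets of intuitionistic logic
  contain each formula or its negation. An existential formula is added with a fresh variable as witness.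
\<close>
lemma henkin_step:
  assumes X: "substitution_closed X" and H: "finite H" "\<not> (X; H \<turnstile> \<^bold>\<bottom>)"
  shows "\<exists>H'. (finite H' \<and> \<not> (X; H' \<turnstile> \<^bold>\<bottom>)) \<and> H \<subseteq> H' \<and>
    ((X; H \<turnstile> \<^bold>\<not> A) \<or> A \<in> H' \<and> (\<forall>B. A = (\<^bold>\<exists> B) \<longrightarrow> (\<exists>t. inst t B \<in> H')))"
proof (cases "X; insert A H \<turnstile> \<^bold>\<bottom>")
  case True
  with H show ?thesis by (auto intro: ImpI)
next
  case False
  show ?thesis
  proof (cases "\<exists>B. A = (\<^bold>\<exists> B)")
    case True
    then obtain B where A: "A = (\<^bold>\<exists> B)" by blast
    obtain k where k: "\<forall>C\<in>insert B (insert A H). bounded k C"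
      using ex_bounded_set[of "insert B (insert A H)"] H(1) by auto
    have "\<not> (X; insert (inst (Var k) B) (insert A H) \<turnstile> \<^bold>\<bottom>)"
    proof
      assume "X; insert (inst (Var k) B) (insert A H) \<turnstile> \<^bold>\<bottom>"
      then have "X; insert A H \<turnstile> \<^bold>\<bottom>"
        by (rule exE_fresh[OF X, rotated -1])
          (use k in \<open>auto simp: A bounded_def intro: Hyp intro: bounded_mono\<close>)
      with False show False ..
    qed
    with H(1) A show ?thesis
      by (intro exI[where x = "insert (inst (Var k) B) (insert A H)"]) auto
  next
    case no: False
    with H(1) False show ?thesis
      by (intro exI[where x = "insert A H"]) auto
  qed
qed

instance fixed :: countable by countable_datatype
instance pt :: countable by countable_datatype
instance fm :: countable by countable_datatype

text \<open>
  Such a theory treats all connectives classically, although it is only closed under intuitionistic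
  derivations.
\<close>
locale complete_theory =
  fixes X :: "fm set" and Th :: "fm \<Rightarrow> bool"
  assumes closed: "substitution_closed X" and stable: "has_stability X"
    and consistent: "\<not> Th \<^bold>\<bottom>"
    and closure: "\<And>G B. finite G \<Longrightarrow> (\<And>A. A \<in> G \<Longrightarrow> Th A) \<Longrightarrow> X; G \<turnstile> B \<Longrightarrow> Th B"
    and decides: "\<And>A. Th A \<or> Th (\<^bold>\<not> A)"
    and witness: "\<And>B. Th (\<^bold>\<exists> B) \<Longrightarrow> \<exists>t. Th (inst t B)"

text \<open>
  The stages remain finite, which leaves fresh variables for the witnesses at every stage.
\<close>
lemma ex_complete_theory:
  assumes X: "substitution_closed X" "has_stability X" and H: "finite H" "\<not> (X; H \<turnstile> \<^bold>\<bottom>)"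
  shows "\<exists>Th. complete_theory X Th \<and> (\<forall>A\<in>H. Th A)"
proof -
  let ?Q = "\<lambda>n H H'. H \<subseteq> H' \<and> ((X; H \<turnstile> \<^bold>\<not> from_nat n) \<or> from_nat n \<in> H' \<and>
     (\<forall>B. from_nat n = (\<^bold>\<exists> B) \<longrightarrow> (\<exists>t. inst t B \<in> H')))"
  have "\<exists>S. \<forall>n. ((finite (S n) \<and> \<not> (X; S n \<turnstile> \<^bold>\<bottom>)) \<and> (n = 0 \<longrightarrow> S n = H)) \<and> ?Q n (S n) (S (Suc n))"
  proof (rule dependent_nat_choice, goal_cases)
    case 1
    then show ?case using H by blast
  next
    case (2 S n)
    then have S: "finite S" "\<not> (X; S \<turnstile> \<^bold>\<bottom>)" by blast+
    obtain H' where "(finite H' \<and> \<not> (X; H' \<turnstile> \<^bold>\<bottom>)) \<and> ?Q n S H'"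
      using henkin_step[OF X(1) S, of "from_nat n"] by (rule exE)
    then show ?case by (intro exI[where x = H']) simp
  qed
  then obtain S where S: "\<forall>n. ((finite (S n) \<and> \<not> (X; S n \<turnstile> \<^bold>\<bottom>)) \<and> (n = 0 \<longrightarrow> S n = H)) \<and>
      ?Q n (S n) (S (Suc n))" by (rule exE)
  have con: "\<not> (X; S n \<turnstile> \<^bold>\<bottom>)" and S0: "S 0 = H" and Sub: "S n \<subseteq> S (Suc n)" for n
    using S by simp_all
  have dec: "?Q n (S n) (S (Suc n))" for n using S by (rule allE) (erule conjunct2)
  define Th where "Th A \<longleftrightarrow> (\<exists>n. X; S n \<turnstile> A)" for A
  have mono: "S n \<subseteq> S m" if "n \<le> m" for n m
    using lift_Suc_mono_le[of S, OF Sub that] .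
  have stage: "\<exists>n. \<forall>A\<in>G. X; S n \<turnstile> A" if "finite G" "\<And>A. A \<in> G \<Longrightarrow> Th A" for G
    using that
  proof (induction rule: finite_induct)
    case (insert A G)
    then obtain n m where n: "\<forall>A\<in>G. X; S n \<turnstile> A" and m: "X; S m \<turnstile> A"
      unfolding Th_def by (meson insertI1 insertI2)
    then have "\<forall>B\<in>insert A G. X; S (max n m) \<turnstile> B"
      using weaken[OF _ mono[of n "max n m"]] weaken[OF m mono[of m "max n m"]] by auto
    then show ?case ..
  qed auto
  have clo: "Th B" if "finite G" "\<And>A. A \<in> G \<Longrightarrow> Th A" "X; G \<turnstile> B" for G B
    using stage[OF that(1,2)] cut_set[OF that(1,3)] by (auto simp: Th_def)
  have decide: "Th (\<^bold>\<not> A) \<or> Th A \<and> (\<forall>B. A = (\<^bold>\<exists> B) \<longrightarrow> (\<exists>t. Th (inst t B)))" for A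
  proof -
    have "B \<in> S n \<Longrightarrow> Th B" for B n unfolding Th_def by (meson Hyp)
    with dec[of "to_nat A"] show ?thesis by (simp, metis Th_def)
  qed
  have ncon: "\<not> Th \<^bold>\<bottom>" using con by (auto simp: Th_def)
  have "complete_theory X Th"
  proof
    fix B assume ex: "Th (\<^bold>\<exists> B)"
    have "X; {\<^bold>\<exists> B, \<^bold>\<not> (\<^bold>\<exists> B)} \<turnstile> \<^bold>\<bottom>" by (meson Hyp ImpE insertI1 insertI2)
    then have "\<not> Th (\<^bold>\<not> (\<^bold>\<exists> B))" using clo[of "{\<^bold>\<exists> B, \<^bold>\<not> (\<^bold>\<exists> B)}" "\<^bold>\<bottom>"] ex ncon by auto
    then show "\<exists>t. Th (inst t B)" using decide[of "\<^bold>\<exists> B"] by blast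
  next
    show "Th A \<or> Th (\<^bold>\<not> A)" for A using decide[of A] by argo
  qed (use X ncon clo in simp_all)
  moreover have "\<forall>A\<in>H. Th A" using S0 unfolding Th_def by (metis Hyp)
  ultimately show ?thesis by blast
qed

section \<open>Classical models\<close>

primrec pt_val :: "(fixed \<Rightarrow> 'a) \<Rightarrow> (nat \<Rightarrow> 'a) \<Rightarrow> pt \<Rightarrow> 'a" where
  "pt_val F e (Var n) = e n"
| "pt_val F e (Fix c) = F c"

primrec sat :: "('a \<Rightarrow> 'a \<Rightarrow> 'a \<Rightarrow> bool) \<Rightarrow> ('a \<Rightarrow> 'a \<Rightarrow> 'a \<Rightarrow> 'a \<Rightarrow> bool) \<Rightarrow> ('a \<Rightarrow> 'a \<Rightarrow> 'a \<Rightarrow> bool) \<Rightarrow>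
    (fixed \<Rightarrow> 'a) \<Rightarrow> (nat \<Rightarrow> 'a) \<Rightarrow> fm \<Rightarrow> bool" where
  "sat B C L F e \<^bold>\<bottom> = False"
| "sat B C L F e (a \<^bold>= b) = (pt_val F e a = pt_val F e b)"
| "sat B C L F e (Bet a b c) = B (pt_val F e a) (pt_val F e b) (pt_val F e c)"
| "sat B C L F e (Cong a b c d) = C (pt_val F e a) (pt_val F e b) (pt_val F e c) (pt_val F e d)"
| "sat B C L F e (Lft a b c) = L (pt_val F e a) (pt_val F e b) (pt_val F e c)"
| "sat B C L F e (P \<^bold>\<and> Q) = (sat B C L F e P \<and> sat B C L F e Q)"
| "sat B C L F e (P \<^bold>\<or> Q) = (sat B C L F e P \<or> sat B C L F e Q)"
| "sat B C L F e (P \<^bold>\<longrightarrow> Q) = (sat B C L F e P \<longrightarrow> sat B C L F e Q)"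
| "sat B C L F e (\<^bold>\<forall> P) = (\<forall>d. sat B C L F (case_nat d e) P)"
| "sat B C L F e (\<^bold>\<exists> P) = (\<exists>d. sat B C L F (case_nat d e) P)"

context complete_theory
begin

lemma Th_derivable: "X; {} \<turnstile> A \<Longrightarrow> Th A"
  using closure[of "{}"] by auto

lemma Th_axiom: "A \<in> X \<Longrightarrow> Th A"
  by (auto intro: Th_derivable Axiom)

lemma Th_1: "Th A \<Longrightarrow> X; {A} \<turnstile> B \<Longrightarrow> Th B"
  using closure[of "{A}"] by auto

lemma Th_2: "Th A \<Longrightarrow> Th B \<Longrightarrow> X; {A, B} \<turnstile> C \<Longrightarrow> Th C"
  using closure[of "{A, B}"] by auto

lemma Th_Imp [simp]: "Th (A \<^bold>\<longrightarrow> B) \<longleftrightarrow> (Th A \<longrightarrow> Th B)"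
proof
  have "X; {A \<^bold>\<longrightarrow> B, A} \<turnstile> B" by (meson Hyp ImpE insertI1 insertI2)
  then show "Th (A \<^bold>\<longrightarrow> B) \<Longrightarrow> Th A \<longrightarrow> Th B" using Th_2 by blast
next
  assume *: "Th A \<longrightarrow> Th B"
  have "X; {\<^bold>\<not> A} \<turnstile> A \<^bold>\<longrightarrow> B" by (meson FalsumE Hyp ImpE ImpI insertI1 insertI2)
  moreover have "X; {B} \<turnstile> A \<^bold>\<longrightarrow> B" by (meson Hyp ImpI insertI1 insertI2)
  ultimately show "Th (A \<^bold>\<longrightarrow> B)" using * decides[of A] Th_1 by blast
qed

lemma Th_Falsum [simp]: "\<not> Th \<^bold>\<bottom>" by (rule consistent)

lemma Th_And [simp]: "Th (A \<^bold>\<and> B) \<longleftrightarrow> Th A \<and> Th B"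
proof -
  have "X; {A \<^bold>\<and> B} \<turnstile> A" "X; {A \<^bold>\<and> B} \<turnstile> B" "X; {A, B} \<turnstile> A \<^bold>\<and> B"
    by (auto intro: AndE1 AndE2 AndI Hyp)
  then show ?thesis using Th_1 Th_2 by blast
qed

lemma Th_Or [simp]: "Th (A \<^bold>\<or> B) \<longleftrightarrow> Th A \<or> Th B"
proof -
  have "X; {A} \<turnstile> A \<^bold>\<or> B" "X; {B} \<turnstile> A \<^bold>\<or> B" by (auto intro: OrI1 OrI2 Hyp)
  moreover have "Th \<^bold>\<bottom>" if "Th (\<^bold>\<not> A)" "Th (\<^bold>\<not> B)" "Th (A \<^bold>\<or> B)"
  proof (rule closure[of "{\<^bold>\<not> A, \<^bold>\<not> B, A \<^bold>\<or> B}"])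
    show "X; {\<^bold>\<not> A, \<^bold>\<not> B, A \<^bold>\<or> B} \<turnstile> \<^bold>\<bottom>"
      by (rule OrE[of _ _ A B]) (meson Hyp ImpE insertI1 insertI2)+
  qed (use that in auto)
  ultimately show ?thesis using Th_1 decides[of A] decides[of B] by auto
qed

lemma Th_Exists [simp]: "Th (\<^bold>\<exists> A) \<longleftrightarrow> (\<exists>t. Th (inst t A))"
proof -
  have "X; {inst t A} \<turnstile> \<^bold>\<exists> A" for t by (auto intro: ExI Hyp)
  then show ?thesis using Th_1 witness by blast
qed

lemma Th_Forall [simp]:
  assumes "stable_fm A" shows "Th (\<^bold>\<forall> A) \<longleftrightarrow> (\<forall>t. Th (inst t A))"
proof -
  have "X; {\<^bold>\<forall> A} \<turnstile> inst t A" for t by (auto intro: AllE Hyp)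
  moreover have "Th (\<^bold>\<forall> A)" if "Th (\<^bold>\<not> (\<^bold>\<exists> (\<^bold>\<not> A)))"
    using Th_1[OF that not_ex_not[OF closed stable assms]] .
  moreover have "inst t (\<^bold>\<not> A) = (\<^bold>\<not> inst t A)" for t by (simp add: inst_def)
  ultimately show ?thesis using Th_1 by auto
qed

lemma Th_Eq_refl: "Th (t \<^bold>= t)" by (intro Th_derivable EqI)

lemma Th_Eq_subst: "Th (s \<^bold>= t) \<Longrightarrow> Th (inst s A) \<Longrightarrow> Th (inst t A)"
  by (erule (1) Th_2) (meson EqE Hyp insertI1 insertI2)

lemma inst_lifted_pt [simp]: "sub_pt (\<lambda>n. case n of 0 \<Rightarrow> t | Suc m \<Rightarrow> Var m) (up (Suc 0) p) = p"
  by (cases p) auto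

lemma Th_Eq_sym: "Th (s \<^bold>= t) \<Longrightarrow> Th (t \<^bold>= s)"
  using Th_Eq_subst[of s t "Var 0 \<^bold>= up 1 s"] Th_Eq_refl by (auto simp: inst_def)

lemma Th_Eq_trans: "Th (r \<^bold>= s) \<Longrightarrow> Th (s \<^bold>= t) \<Longrightarrow> Th (r \<^bold>= t)"
  using Th_Eq_subst[of s t "up 1 r \<^bold>= Var 0"] by (auto simp: inst_def)

lemma Th_Bet_subst: "Th (a \<^bold>= a') \<Longrightarrow> Th (b \<^bold>= b') \<Longrightarrow> Th (c \<^bold>= c') \<Longrightarrow> Th (Bet a b c) \<Longrightarrow> Th (Bet a' b' c')"
  using Th_Eq_subst[of a a' "Bet (Var 0) (up 1 b) (up 1 c)"]
    Th_Eq_subst[of b b' "Bet (up 1 a') (Var 0) (up 1 c)"]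
    Th_Eq_subst[of c c' "Bet (up 1 a') (up 1 b') (Var 0)"] by (auto simp: inst_def)

lemma Th_Lft_subst: "Th (a \<^bold>= a') \<Longrightarrow> Th (b \<^bold>= b') \<Longrightarrow> Th (c \<^bold>= c') \<Longrightarrow> Th (Lft a b c) \<Longrightarrow> Th (Lft a' b' c')"
  using Th_Eq_subst[of a a' "Lft (Var 0) (up 1 b) (up 1 c)"]
    Th_Eq_subst[of b b' "Lft (up 1 a') (Var 0) (up 1 c)"]
    Th_Eq_subst[of c c' "Lft (up 1 a') (up 1 b') (Var 0)"] by (auto simp: inst_def)

lemma Th_Cong_subst: "Th (a \<^bold>= a') \<Longrightarrow> Th (b \<^bold>= b') \<Longrightarrow> Th (c \<^bold>= c') \<Longrightarrow> Th (d \<^bold>= d') \<Longrightarrow>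
  Th (Cong a b c d) \<Longrightarrow> Th (Cong a' b' c' d')"
  using Th_Eq_subst[of a a' "Cong (Var 0) (up 1 b) (up 1 c) (up 1 d)"]
    Th_Eq_subst[of b b' "Cong (up 1 a') (Var 0) (up 1 c) (up 1 d)"]
    Th_Eq_subst[of c c' "Cong (up 1 a') (up 1 b') (Var 0) (up 1 d)"]
    Th_Eq_subst[of d d' "Cong (up 1 a') (up 1 b') (up 1 c') (Var 0)"] by (auto simp: inst_def)

text \<open>
  The term model consists of the points of the logic modulo equality in the theory. The points \<open>t i\<close>
  ensure that it is infinite; being countable, it can then be numbered by all natural numbers, so that the
  domain of the model is a fixed type.
\<close>
lemma ex_model:
  fixes t :: "nat \<Rightarrow> pt"
  assumes distinct: "\<And>i j. i < j \<Longrightarrow> \<not> Th (t i \<^bold>= t j)"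
  shows "\<exists>(B :: nat \<Rightarrow> nat \<Rightarrow> nat \<Rightarrow> bool) C L F e. (\<forall>A. stable_foralls A \<longrightarrow> Th A \<longrightarrow> sat B C L F e A) \<and>
    (\<forall>A. stable_foralls A \<longrightarrow> sat B C L F e A \<longrightarrow> Th A) \<and> (\<forall>A\<in>X. stable_foralls A \<longrightarrow> (\<forall>e. sat B C L F e A))"
proof -
  define R where "R = {(a, b). Th (a \<^bold>= b)}"
  have R: "equiv UNIV R"
    by (auto simp: R_def equiv_def refl_on_def sym_def trans_def intro: Th_Eq_refl Th_Eq_sym Th_Eq_trans)
  have cl: "R `` {a} = R `` {b} \<longleftrightarrow> Th (a \<^bold>= b)" for a b
    using eq_equiv_class_iff[OF R] by (auto simp: R_def)
  let ?D = "range (\<lambda>a. R `` {a})"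
  have "inj (\<lambda>n. R `` {t n})"
    unfolding inj_on_def cl using distinct Th_Eq_sym by (metis linorder_neqE_nat)
  then have "infinite (range (\<lambda>n. R `` {t n}))" by (rule range_inj_infinite)
  moreover have "range (\<lambda>n. R `` {t n}) \<subseteq> ?D" by auto
  ultimately have inf: "infinite ?D" using infinite_super by blast
  have cnt: "countable ?D" by simp
  define num where "num a = to_nat_on ?D (R `` {a})" for a
  have num: "num a = num b \<longleftrightarrow> Th (a \<^bold>= b)" for a b
    unfolding num_def cl[symmetric] using cnt by (subst to_nat_on_inj) auto
  \<comment> \<open>This is where an infinite quotient is needed.\<close>
  have surj: "\<exists>a. d = num a" for d
  proof -
    have "d \<in> to_nat_on ?D ` ?D" using to_nat_on_surj[OF cnt inf, of d] by auto
    then show ?thesis by (auto simp: num_def)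
  qed
  define B where "B k l m \<longleftrightarrow> (\<exists>a b c. k = num a \<and> l = num b \<and> m = num c \<and> Th (Bet a b c))" for k l m
  define L where "L k l m \<longleftrightarrow> (\<exists>a b c. k = num a \<and> l = num b \<and> m = num c \<and> Th (Lft a b c))" for k l m
  define C where "C k l m n \<longleftrightarrow> (\<exists>a b c d. k = num a \<and> l = num b \<and> m = num c \<and> n = num d \<and>
    Th (Cong a b c d))" for k l m n
  define F where "F f = num (Fix f)" for f
  have B: "B (num a) (num b) (num c) \<longleftrightarrow> Th (Bet a b c)" for a b c
    unfolding B_def num by (meson Th_Bet_subst Th_Eq_sym Th_Eq_refl)
  have L: "L (num a) (num b) (num c) \<longleftrightarrow> Th (Lft a b c)" for a b c
    unfolding L_def num by (meson Th_Lft_subst Th_Eq_sym Th_Eq_refl)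
  have C: "C (num a) (num b) (num c) (num d) \<longleftrightarrow> Th (Cong a b c d)" for a b c d
    unfolding C_def num by (meson Th_Cong_subst Th_Eq_sym Th_Eq_refl)
  have val: "pt_val F (\<lambda>n. num (s n)) p = num (sub_pt s p)" for s p
    by (cases p) (auto simp: F_def)
  have env: "case_nat (num a) (\<lambda>n. num (s n)) = (\<lambda>n. num (case_nat a s n))" for a s
    by (auto simp: fun_eq_iff split: nat.split)
  have quant: "(\<exists>d. P d) \<longleftrightarrow> (\<exists>a. P (num a))" "(\<forall>d. P d) \<longleftrightarrow> (\<forall>a. P (num a))" for P
    by (metis surj)+
  \<comment> \<open>Quantifying over all substitutions \<open>s\<close> makes the induction pass under the quantifiers.\<close>
  have truth: "stable_foralls A \<Longrightarrow> sat B C L F (\<lambda>n. num (s n)) A \<longleftrightarrow> Th (sub s A)" for A s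
  proof (induction A arbitrary: s)
    case (Forall A)
    then show ?case unfolding sat.simps quant env by (simp add: inst_sub_under)
  next
    case (Exists A)
    then show ?case unfolding sat.simps quant env by (simp add: inst_sub_under)
  qed (auto simp: val num B C L)
  have "sat B C L F e A" if "A \<in> X" "stable_foralls A" for e A
  proof -
    have "\<exists>s. \<forall>n. e n = num (s n)" by (intro choice allI surj)
    then obtain s where "e = (\<lambda>n. num (s n))" by auto
    with that truth show ?thesis using closed by (auto simp: substitution_closed_def intro: Th_axiom)
  qed
  moreover have "sat B C L F (\<lambda>n. num (Var n)) A \<longleftrightarrow> Th A" if "stable_foralls A" for A
    using truth[OF that, of Var] by (simp add: sub_Var)
  ultimately show ?thesis by blast
qed

end

section \<open>Betweenness and congruence in a model\<close>

definition weakly_between :: "('a \<Rightarrow> 'a \<Rightarrow> 'a \<Rightarrow> bool) \<Rightarrow> 'a \<Rightarrow> 'a \<Rightarrow> 'a \<Rightarrow> bool" where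
  "weakly_between B a b c \<longleftrightarrow> a = b \<or> b = c \<or> B a b c"

definition on_line :: "('a \<Rightarrow> 'a \<Rightarrow> 'a \<Rightarrow> bool) \<Rightarrow> 'a \<Rightarrow> 'a \<Rightarrow> 'a \<Rightarrow> bool" where
  "on_line B x a b \<longleftrightarrow> B a b x \<or> B b x a \<or> B x a b \<or> x = a \<or> x = b"

definition precedes :: "('a \<Rightarrow> 'a \<Rightarrow> 'a \<Rightarrow> bool) \<Rightarrow> 'a \<Rightarrow> 'a \<Rightarrow> 'a \<Rightarrow> 'a \<Rightarrow> bool" where
  "precedes B a b u v \<longleftrightarrow>
    (\<not> weakly_between B a b u \<longrightarrow> \<not> B v u b) \<and> (\<not> weakly_between B u a b \<longrightarrow> weakly_between B a u v)"

text \<open>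
  The axioms as they read in a classical model, with \<open>B\<close>, \<open>C\<close>, \<open>L\<close> for betweenness, congruence
  and handedness.
\<close>
locale geometry =
  fixes B :: "'a \<Rightarrow> 'a \<Rightarrow> 'a \<Rightarrow> bool"
    and C :: "'a \<Rightarrow> 'a \<Rightarrow> 'a \<Rightarrow> 'a \<Rightarrow> bool"
    and L :: "'a \<Rightarrow> 'a \<Rightarrow> 'a \<Rightarrow> bool"
  assumes cong_swap: "C a b b a"
    and cong_trans: "C a b p q \<Longrightarrow> C a b r s \<Longrightarrow> C p q r s"
    and cong_null: "C a b c c \<Longrightarrow> a = b"
    and ex_ext: "a \<noteq> b \<Longrightarrow> \<exists>x. weakly_between B a b x \<and> C b x c d"
    and cong_five_seg: "a \<noteq> b \<Longrightarrow> weakly_between B a b c \<Longrightarrow> weakly_between B a' b' c' \<Longrightarrow> C a b a' b' \<Longrightarrow> C b c b' c' \<Longrightarrow>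
      C a p a' p' \<Longrightarrow> C b p b' p' \<Longrightarrow> C c p c' p'"
    and B_sym: "B a b c \<Longrightarrow> B c b a"
    and B_neq: "B a b c \<Longrightarrow> a \<noteq> b"
    and B_irrefl: "\<not> B a b a"
    and bw_inner: "weakly_between B a b d \<Longrightarrow> weakly_between B b c d \<Longrightarrow> weakly_between B a b c \<and> weakly_between B a c d"
    and bw_outer: "weakly_between B a b c \<Longrightarrow> weakly_between B b c d \<Longrightarrow> b \<noteq> c \<Longrightarrow> weakly_between B a c d \<and> weakly_between B a b d"
    and B_connect: "B a b c \<Longrightarrow> B a b d \<Longrightarrow> weakly_between B a c d \<or> weakly_between B a d c"
    and upper_dim: "p \<noteq> q \<Longrightarrow> C a p a q \<Longrightarrow> C b p b q \<Longrightarrow> C c p c q \<Longrightarrow>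
      \<exists>u v. u \<noteq> v \<and> on_line B a u v \<and> on_line B b u v \<and> on_line B c u v"
    and circle_circle: "c \<noteq> d \<Longrightarrow> C c u p q \<Longrightarrow> C c v p q \<Longrightarrow> \<exists>e. weakly_between B r e s \<and> C d u r e \<Longrightarrow>
      \<exists>e. weakly_between B d e v \<and> C r s d e \<Longrightarrow> \<exists>x. C c x p q \<and> C d x r s"
    and L_off: "L a b c \<Longrightarrow> a \<noteq> b \<and> \<not> on_line B c a b"
    and L_asym: "L a b c \<Longrightarrow> \<not> L b a c"
    and L_total: "a \<noteq> b \<Longrightarrow> \<not> on_line B c a b \<Longrightarrow> L a b c \<or> L b a c"
    and L_cyclic: "L a b c \<Longrightarrow> L b c a"
    and L_same: "L a b c \<Longrightarrow> \<not> on_line B d a b \<Longrightarrow> \<not> (\<exists>p. on_line B p a b \<and> B c p d) \<Longrightarrow> L a b d"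
    and L_opposite: "L a b c \<Longrightarrow> on_line B p a b \<Longrightarrow> B c p d \<Longrightarrow> L b a d"
    and left_circles: "c \<noteq> d \<Longrightarrow> C c x p q \<Longrightarrow> C d x r s \<Longrightarrow>
      \<exists>z. C c z p q \<and> C d z r s \<and> \<not> L d c z"
begin

abbreviation bw where "bw \<equiv> weakly_between B"
abbreviation on where "on \<equiv> on_line B"
lemmas bw_def = weakly_between_def[of B]
lemmas on_def = on_line_def[of B]

text \<open>
  The congruence class of a segment. It turns congruence into equality, for which equational reasoning
  is available.
\<close>
definition len :: "'a \<Rightarrow> 'a \<Rightarrow> ('a \<times> 'a) set" where
  "len a b = {(p, q). C a b p q}"

lemma C_len: "C a b p q \<longleftrightarrow> len a b = len p q"
proof
  have C_refl: "C a b a b" for a b using cong_swap cong_trans by blast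
  have sym: "C a b p q \<Longrightarrow> C p q a b" for a b p q using C_refl cong_trans by blast
  show "C a b p q \<Longrightarrow> len a b = len p q"
    unfolding len_def using cong_trans sym by blast
  show "len a b = len p q \<Longrightarrow> C a b p q" unfolding len_def using C_refl by blast
qed

lemma len_sym: "len a b = len b a" unfolding C_len[symmetric] by (rule cong_swap)

lemma len_null: "len a b = len c c \<Longrightarrow> a = b" unfolding C_len[symmetric] by (rule cong_null)

lemma ext: "a \<noteq> b \<Longrightarrow> \<exists>x. bw a b x \<and> len b x = len c d"
  unfolding C_len[symmetric] by (rule ex_ext)

lemma five_seg: "a \<noteq> b \<Longrightarrow> bw a b c \<Longrightarrow> bw a' b' c' \<Longrightarrow> len a b = len a' b' \<Longrightarrow> len b c = len b' c' \<Longrightarrow>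
      len a p = len a' p' \<Longrightarrow> len b p = len b' p' \<Longrightarrow> len c p = len c' p'"
  unfolding C_len[symmetric] by (rule cong_five_seg)

lemma len_point: "len a a = len b b"
proof (cases "a = b")
  case False
  then obtain x where "len b x = len a a" using ext by metis
  then show ?thesis using len_null by metis
qed simp

lemma bw_sym: "bw a b c \<Longrightarrow> bw c b a" unfolding bw_def using B_sym by blast
lemma bw_left [simp]: "bw a a b" unfolding bw_def by blast
lemma bw_right [simp]: "bw a b b" unfolding bw_def by blast
lemma bw_aba: "bw a b a \<Longrightarrow> a = b" unfolding bw_def using B_irrefl by blast
lemma B_neq2: "B a b c \<Longrightarrow> b \<noteq> c" using B_sym B_neq by metis
lemma B_bw: "B a b c \<longleftrightarrow> bw a b c \<and> a \<noteq> b \<and> b \<noteq> c" unfolding bw_def using B_neq B_neq2 by blast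
lemma bw_inner2: "bw a c d \<Longrightarrow> bw a b c \<Longrightarrow> bw a b d \<and> bw b c d" using bw_inner bw_sym by meson
lemma bw_antisym: "bw a b c \<Longrightarrow> bw a c b \<Longrightarrow> b = c" using bw_inner2 bw_aba by blast
lemma bw_antisym2: "bw a b c \<Longrightarrow> bw b a c \<Longrightarrow> a = b" using bw_antisym bw_sym by blast
lemma bw_conn: "a \<noteq> b \<Longrightarrow> bw a b c \<Longrightarrow> bw a b d \<Longrightarrow> bw a c d \<or> bw a d c"
  unfolding bw_def using B_connect[unfolded bw_def] by blast
lemma bw_conn2: "a \<noteq> b \<Longrightarrow> bw a b c \<Longrightarrow> bw a b d \<Longrightarrow> bw b c d \<or> bw b d c"
  using bw_conn bw_inner2 by meson

lemma nontrivial_ext: "a \<noteq> b \<Longrightarrow> \<exists>x. bw a b x \<and> b \<noteq> x"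
  using ext[of a b a b] len_null by metis

lemma bw_conn_in: "bw a b d \<Longrightarrow> bw a c d \<Longrightarrow> bw a b c \<or> bw a c b"
proof (cases "a = d")
  case True
  then show "bw a b d \<Longrightarrow> bw a c d \<Longrightarrow> ?thesis" using bw_aba by blast
next
  case False
  assume *: "bw a b d" "bw a c d"
  \<comment> \<open>Looked at from a point beyond \<open>a\<close>, this is the case of the connectivity axiom.\<close>
  obtain e where e: "bw d a e" "a \<noteq> e" using False nontrivial_ext by metis
  then have "bw e a b" "bw e a c" using * bw_sym bw_inner by meson+
  with e bw_conn2[of e a b c] show ?thesis by metis
qed

lemma bw_add: "bw a b c \<Longrightarrow> bw a' b' c' \<Longrightarrow> len a b = len a' b' \<Longrightarrow> len b c = len b' c' \<Longrightarrow> len a c = len a' c'"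
  using five_seg[of a b c a' b' c' a a'] len_point len_null len_sym by metis

lemma ext_unique: "a \<noteq> b \<Longrightarrow> bw a b c \<Longrightarrow> bw a b c' \<Longrightarrow> len b c = len b c' \<Longrightarrow> c = c'"
  using five_seg[of a b c a b c' c c'] bw_add[of a b c a b c'] five_seg[of a b c a b c c c'] len_null len_sym by metis

text \<open>
  Prolong \<open>ac\<close> beyond \<open>c\<close> to \<open>e\<close>: the five-segment axiom gives the distance of \<open>p\<close> from \<open>e\<close>, and,
  used backwards from \<open>e\<close> over \<open>c\<close>, that from \<open>b\<close>.
\<close>
lemma inner_five_seg:
  assumes "bw a b c" "bw a' b' c'" "len a c = len a' c'" "len b c = len b' c'"
    "len a p = len a' p'" "len c p = len c' p'"
  shows "len b p = len b' p'"
proof (cases "a = c")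
  case True
  then have "a' = c'" using assms(3) len_null by metis
  then have "a = b" "a' = b'" using assms True bw_aba by metis+
  then show ?thesis using assms by simp
next
  case False
  then obtain e where e: "bw a c e" "c \<noteq> e" using nontrivial_ext by metis
  have "a' \<noteq> c'" using False assms(3) len_null by metis
  then obtain e' where e': "bw a' c' e'" "len c' e' = len c e" using ext by metis
  have "len e p = len e' p'"
    using five_seg[of a c e a' c' e' p p'] False e e' assms by metis
  moreover have "bw e c b" "bw e' c' b'" using e e' assms(1,2) bw_inner2 bw_sym by meson+
  ultimately show ?thesis
    using five_seg[of e c b e' c' b' p p'] e e' assms len_sym by metis
qed

lemma bw_diff: "bw a b c \<Longrightarrow> bw a' b' c' \<Longrightarrow> len a c = len a' c' \<Longrightarrow> len b c = len b' c' \<Longrightarrow> len a b = len a' b'"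
  using inner_five_seg[of a b c a' b' c' a a'] len_sym len_point by metis

text \<open>
  Lay off \<open>ab\<close> and \<open>bc\<close> on the ray from \<open>a'\<close> to \<open>c'\<close>, which is reached from a point \<open>o'\<close> on the opposite
  ray; by uniqueness of extensions one arrives at \<open>c'\<close>.
\<close>
lemma bw_copy:
  assumes "bw a b c" "len a c = len a' c'"
  shows "\<exists>b'. bw a' b' c' \<and> len a b = len a' b' \<and> len b c = len b' c'"
proof (cases "a = c")
  case True
  then show ?thesis using assms bw_aba len_null by (metis bw_left)
next
  case False
  then have ne: "c' \<noteq> a'" using assms(2) len_null by metis
  then obtain o' where o': "bw c' a' o'" "a' \<noteq> o'" using nontrivial_ext by metis
  obtain b' where b': "bw o' a' b'" "len a' b' = len a b" using o' ext by metis
  show ?thesis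
  proof (cases "a' = b'")
    case True
    then have "a = b" using b' len_null by metis
    then show ?thesis using assms by (intro exI[of _ a']) (auto simp: len_point)
  next
    case ne': False
    then obtain c2 where c2: "bw a' b' c2" "len b' c2 = len b c" using ext by metis
    have "len a' c2 = len a c" using bw_add[of a b c a' b' c2] assms(1) b' c2 by metis
    moreover have "bw o' a' c2" using b' c2 ne' bw_outer by metis
    moreover have "bw o' a' c'" using o' bw_sym by metis
    ultimately have "c2 = c'" using ext_unique[of o' a' c2 c'] o' assms by metis
    then show ?thesis using b' c2 by metis
  qed
qed

text \<open>
  The copy of \<open>b\<close> on \<open>a'c'\<close> has distance zero from \<open>b'\<close>.
\<close>
lemma bw_cong:
  assumes "bw a b c" "len a b = len a' b'" "len b c = len b' c'" "len a c = len a' c'"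
  shows "bw a' b' c'"
proof -
  obtain b2 where b2: "bw a' b2 c'" "len a b = len a' b2" "len b c = len b2 c'"
    using bw_copy assms by metis
  have "len b2 b' = len b2 b2"
    using inner_five_seg[of a' b2 c' a' b2 c' b' b2] b2 assms len_sym by metis
  then show ?thesis using b2 len_null by metis
qed

section \<open>Lines\<close>

definition col :: "'a \<Rightarrow> 'a \<Rightarrow> 'a \<Rightarrow> bool" where
  "col a b c \<longleftrightarrow> bw a b c \<or> bw b c a \<or> bw c a b"

lemma col_rot: "col a b c \<Longrightarrow> col b c a" unfolding col_def by blast
lemma col_swap: "col a b c \<Longrightarrow> col b a c" unfolding col_def using bw_sym by blast
lemma col_triv [simp]: "col a a b" "col a b a" "col b a a" unfolding col_def by simp_all

lemma on_col: "a \<noteq> b \<Longrightarrow> on x a b \<longleftrightarrow> col a b x"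
  unfolding on_def col_def bw_def by blast

text \<open>
  One case of betweenness axioms for each pair of positions of \<open>x\<close> and \<open>y\<close> relative to \<open>p\<close> and \<open>q\<close>.
\<close>
lemma col_line2:
  assumes ne: "p \<noteq> q" and "col p q x" "col p q y"
  shows "col p x y"
proof -
  have pqx: "bw p q x \<or> bw q x p \<or> bw x p q" and pqy: "bw p q y \<or> bw q y p \<or> bw y p q"
    using assms by (auto simp: col_def)
  have 1: "col p x y" if "bw p q x" "bw p q y" for x y
    using bw_conn[OF ne that] bw_sym unfolding col_def by blast
  have 2: "col p x y" if "bw p q x" "bw q y p" for x y
    using bw_inner2[OF that(1) bw_sym[OF that(2)]] bw_sym unfolding col_def by blast
  have 3: "col p x y" if "bw p q x" "bw y p q" for x y
    using bw_outer[OF that(2,1) ne] bw_sym unfolding col_def by blast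
  have 4: "col p x y" if "bw q x p" "bw q y p" for x y
    using bw_conn_in[of p x q y] that bw_sym unfolding col_def by blast
  have 5: "col p x y" if "bw q x p" "bw y p q" for x y
    using bw_inner[OF that(2) bw_sym[OF that(1)]] bw_sym unfolding col_def by blast
  have 6: "col p x y" if "bw x p q" "bw y p q" for x y
    using bw_conn2[of q p x y] that ne bw_sym unfolding col_def by blast
  have s: "col p y x \<Longrightarrow> col p x y" using col_rot col_swap by blast
  show ?thesis using pqx pqy 1 2 3 4 5 6 s by metis
qed

lemma col_line3:
  assumes "p \<noteq> q" "col p q x" "col p q y" "col p q z"
  shows "col x y z"
proof (cases "p = x")
  case True
  then show ?thesis using col_line2 assms by metis
next
  case False
  have "col p x y" "col p x z" using col_line2[OF assms(1)] assms by blast+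
  then show ?thesis using col_line2[of x p y z] False col_swap by metis
qed

lemma bisector_col:
  assumes "p \<noteq> q" "len a p = len a q" "len b p = len b q" "len c p = len c q"
  shows "col a b c"
proof -
  obtain u v where "u \<noteq> v" "on a u v" "on b u v" "on c u v"
    using upper_dim[of p q a b c] assms C_len by metis
  then show ?thesis using on_col[of u v] col_line3[of u v a b c] by metis
qed

lemma five_seg_col:
  assumes ne: "a \<noteq> b" and x: "col a b x"
    and "len a b = len a' b'" "len a x = len a' x'" "len b x = len b' x'"
    and "len a p = len a' p'" "len b p = len b' p'"
  shows "len x p = len x' p'"
proof -
  consider "bw a b x" | "bw b a x" | "bw a x b" using x bw_sym unfolding col_def by blast
  then show ?thesis
  proof cases
    case 1
    then have "bw a' b' x'" using bw_cong[of a b x a' b' x'] assms by metis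
    then show ?thesis using five_seg[of a b x a' b' x' p p'] 1 assms by metis
  next
    case 2
    then have "bw b' a' x'" using bw_cong[of b a x b' a' x'] assms len_sym by metis
    then show ?thesis using five_seg[of b a x b' a' x' p p'] 2 assms len_sym by metis
  next
    case 3
    then have "bw a' x' b'" using bw_cong[of a x b a' x' b'] assms len_sym by metis
    then show ?thesis using inner_five_seg[of a x b a' x' b' p p'] 3 assms len_sym by metis
  qed
qed

lemma equidistant_col:
  "a \<noteq> b \<Longrightarrow> col a b x \<Longrightarrow> len a p = len a q \<Longrightarrow> len b p = len b q \<Longrightarrow> len x p = len x q"
  by (rule five_seg_col[of a b x a b x]) auto

lemma equidistant_bw:
  assumes "bw z x p" "len p z = len p x" shows "z = x"
  using bw_diff[of z x p x x p] assms len_sym len_null by (metis bw_left)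

lemma equidistant_between:
  assumes "a \<noteq> b" "col a b p" "len p a = len p b" shows "bw a p b"
  using assms equidistant_bw[of a b p] equidistant_bw[of b a p] bw_sym unfolding col_def by metis

section \<open>Point reflections\<close>

definition midpoint :: "'a \<Rightarrow> 'a \<Rightarrow> 'a \<Rightarrow> bool" where
  "midpoint m a b \<longleftrightarrow> bw a m b \<and> len m a = len m b"

lemma ex_reflection: "\<exists>b. midpoint m a b"
proof (cases "a = m")
  case True
  then show ?thesis unfolding midpoint_def using bw_left by blast
next
  case False
  then show ?thesis using ext[of a m m a] unfolding midpoint_def by metis
qed

lemma midpoint_unique: "midpoint m a b \<Longrightarrow> midpoint m a c \<Longrightarrow> b = c"
  unfolding midpoint_def using ext_unique[of a m b c] len_null by metis

definition reflect :: "'a \<Rightarrow> 'a \<Rightarrow> 'a" where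
  "reflect m a = (SOME b. midpoint m a b)"

lemma midpoint_reflect: "midpoint m a (reflect m a)"
  unfolding reflect_def using ex_reflection by (rule someI_ex)

lemma reflect_eq: "midpoint m a b \<longleftrightarrow> reflect m a = b" using midpoint_reflect midpoint_unique by blast

lemma midpoint_sym: "midpoint m a b \<Longrightarrow> midpoint m b a" unfolding midpoint_def using bw_sym by metis

lemma reflect_reflect [simp]: "reflect m (reflect m a) = a" using midpoint_sym reflect_eq by blast

lemma bw_reflect: "bw a m (reflect m a)" and len_reflect: "len m (reflect m a) = len m a"
  using midpoint_reflect unfolding midpoint_def by metis+

lemma reflect_self [simp]: "reflect m m = m" using len_reflect[of m m] len_null by metis

lemma reflect_eq_self: "reflect m a = a \<longleftrightarrow> a = m" using bw_reflect[of a m] bw_aba by auto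

text \<open>
  Prolonging \<open>pp'\<close> and \<open>qq'\<close> at both ends yields two segments \<open>xx'\<close> and \<open>yy'\<close> of equal length that bisect each
  other in \<open>m\<close>; the five-segment axiom gives \<open>x'y' = yx\<close>, and inner five segments carry the congruence over to
  \<open>p\<close> and \<open>q\<close>.
\<close>
lemma reflect_isometry: "len (reflect m p) (reflect m q) = len p q"
proof (cases "p = m \<or> q = m")
  case True
  then show ?thesis using len_reflect len_sym by (metis reflect_self)
next
  case False
  then have ne: "p \<noteq> m" "q \<noteq> m" by auto
  define p' q' where "p' = reflect m p" and "q' = reflect m q"
  have mp: "bw p m p'" "len m p' = len m p" and mq: "bw q m q'" "len m q' = len m q"
    unfolding p'_def q'_def using bw_reflect len_reflect by metis+
  have ne': "p \<noteq> p'" "q \<noteq> q'" using ne mp mq bw_aba by blast+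
  \<comment> \<open>Prolong \<open>pp'\<close> by \<open>mq\<close> and \<open>qq'\<close> by \<open>mp\<close> at both ends: the four new points are equally far from \<open>m\<close>.\<close>
  obtain x where x: "bw p' p x" "len p x = len q m" using ext ne' by metis
  obtain y where y: "bw q' q y" "len q y = len p m" using ext ne' by metis
  obtain x' where x': "bw p p' x'" "len p' x' = len q m" using ext ne' by metis
  obtain y' where y': "bw q q' y'" "len q' y' = len p m" using ext ne' by metis
  have Tx: "bw m p x" "bw m p' x'" "bw m q y" "bw m q' y'"
    using x y x' y' mp mq bw_sym bw_inner2 by meson+
  have l: "len m x = len m y" "len m x' = len m x" "len m y' = len m y"
    using bw_add[of m p x y q m] bw_add[of m p' x' m p x] bw_add[of m q' y' m q y]
      Tx x y x' y' mp mq bw_sym len_sym by metis+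
  have nex: "x \<noteq> m" "m \<noteq> p'" "m \<noteq> q'" using Tx ne mp mq bw_aba len_null by metis+
  have "bw x m p'" "bw y m q'" using Tx mp mq ne bw_outer bw_sym by metis+
  then have bw: "bw x m x'" "bw y m y'" using Tx nex bw_outer by metis+
  have "len x' y' = len y x"
    using five_seg[of x m x' y' m y y' x] bw nex l len_sym bw_sym by metis
  moreover have "bw y q m" "bw y' q' m" "bw x p m" "bw x' p' m" using Tx bw_sym by metis+
  ultimately have "len q x = len q' x'"
    using inner_five_seg[of y q m y' q' m x x'] l mq len_sym by metis
  then have "len p q = len p' q'"
    using inner_five_seg[of x p m x' p' m q q'] \<open>bw x p m\<close> \<open>bw x' p' m\<close> l mp mq len_sym by metis
  then show ?thesis unfolding p'_def q'_def by simp
qed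

lemma reflect_bw: "bw a b c \<Longrightarrow> bw (reflect m a) (reflect m b) (reflect m c)"
  using bw_cong reflect_isometry by metis

section \<open>Midpoints and the sides of a line\<close>

lemma on_swap: "on x a b \<Longrightarrow> on x b a" unfolding on_def using B_sym by blast

lemma equilateral:
  assumes "a \<noteq> b" shows "\<exists>x. len a x = len a b \<and> len b x = len a b"
proof -
  \<comment> \<open>On the circle about \<open>a\<close>, the point \<open>b\<close> is the center of the other circle, and the antipode of \<open>b\<close> is outside of it.\<close>
  obtain v where v: "bw b a v" "len a v = len a b" using ext assms by metis
  have "\<exists>e. bw a e b \<and> C b b a e" using len_point C_len bw_left by metis
  moreover have "\<exists>e. bw b e v \<and> C a b b e" using v C_len len_sym by metis
  ultimately show ?thesis
    using circle_circle[of a b b a b v a b] assms v C_len by metis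
qed

lemma apex_left:
  assumes "a \<noteq> b" "len a u = len a b" "len b u = len a b" "\<not> L b a u"
  shows "L a b u"
proof -
  have False if "on u a b"
  proof -
    have "bw a u b" using that on_col equidistant_between assms len_sym by metis
    then have "b = u" using equidistant_bw[of b u a] assms bw_sym by metis
    then show False using assms len_null by metis
  qed
  then show ?thesis using L_total assms by metis
qed

lemma ex_apexes:
  assumes "a \<noteq> b"
  shows "\<exists>u v. L a b u \<and> L b a v \<and> len a u = len b u \<and> len a v = len b v"
proof -
  obtain x where x: "len a x = len a b" "len b x = len a b" using equilateral assms by metis
  obtain u where u: "len a u = len a b" "len b u = len a b" "\<not> L b a u"
    using left_circles[of a b x a b a b] x assms C_len by metis
  obtain v where v: "len b v = len a b" "len a v = len a b" "\<not> L a b v"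
    using left_circles[of b a x a b a b] x assms C_len by metis
  show ?thesis using apex_left[of a b u] apex_left[of b a v] u v assms len_sym by metis
qed

text \<open>
  The apexes of the two equilateral triangles over \<open>ab\<close> lie on different sides of the line, and the point
  where the segment between them crosses it is equidistant from \<open>a\<close> and \<open>b\<close>.
\<close>
lemma ex_midpoint: "\<exists>m. midpoint m a b"
proof (cases "a = b")
  case True
  then show ?thesis unfolding midpoint_def using bw_left by blast
next
  case False
  obtain u v where uv: "L a b u" "L b a v" "len a u = len b u" "len a v = len b v"
    using ex_apexes False by metis
  have "\<not> L a b v" "\<not> on v a b" using uv L_off L_asym on_swap by blast+
  then obtain p where p: "on p a b" "B u p v" using L_same uv by blast
  have "u \<noteq> v" "col u v p" using p B_irrefl B_bw col_def bw_sym by metis+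
  then have "len p a = len p b" using equidistant_col[of u v p a b] uv(3,4) len_sym by metis
  then show ?thesis
    unfolding midpoint_def using equidistant_between False p on_col by metis
qed

lemma on_bisector:
  assumes "s \<noteq> t" "u \<noteq> v" "len u s = len u t" "len v s = len v t"
  shows "on y u v \<longleftrightarrow> len y s = len y t"
  using on_col[of u v y] equidistant_col[of u v y s t] bisector_col[of s t u v y] assms by metis

text \<open>
  The perpendicular bisector of \<open>st\<close> divides the plane into two sides, told apart by \<open>P\<close>: handedness with
  respect to two points of the bisector. Describing a perpendicular as a bisector avoids naming points on it.
\<close>
lemma bisector_sides:
  assumes "s \<noteq> t"
  shows "\<exists>P :: 'a \<Rightarrow> bool. \<forall>w w'. len w s \<noteq> len w t \<longrightarrow> len w' s \<noteq> len w' t \<longrightarrow>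
    (\<exists>y. len y s = len y t \<and> B w y w') \<longleftrightarrow> P w \<noteq> P w'"
proof -
  obtain u v where uv: "L s t u" "L t s v" "len s u = len t u" "len s v = len t v"
    using ex_apexes assms by metis
  then have ne: "u \<noteq> v" using L_asym by blast
  have on: "on y u v \<longleftrightarrow> len y s = len y t" for y
    using on_bisector[of s t u v y] assms uv(3,4) ne len_sym by metis
  have "(\<exists>y. len y s = len y t \<and> B w y w') \<longleftrightarrow> L u v w \<noteq> L u v w'"
    if w: "len w s \<noteq> len w t" "len w' s \<noteq> len w' t" for w w'
  proof -
    have off: "\<not> on w u v" "\<not> on w' u v" "\<not> on w v u" "\<not> on w' v u" using w on on_swap by blast+
    have sw: "on y u v \<longleftrightarrow> on y v u" for y using on_swap by blast
    have total: "L u v w \<or> L v u w" "L u v w' \<or> L v u w'" using L_total ne off by blast+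
    show ?thesis
    proof (cases "\<exists>y. len y s = len y t \<and> B w y w'")
      case True
      then obtain y where y: "on y u v" "on y v u" "B w y w'" using on sw by blast
      have "L u v w \<Longrightarrow> L v u w'" "L v u w \<Longrightarrow> L u v w'" using L_opposite y by blast+
      then show ?thesis using True total L_asym by blast
    next
      case False
      then have "L u v w \<Longrightarrow> L u v w'" "L v u w \<Longrightarrow> L v u w'"
        using L_same[of u v w w'] L_same[of v u w w'] off on sw by blast+
      then show ?thesis using False total L_asym by blast
    qed
  qed
  then show ?thesis by (intro exI[where x = "L u v"]) blast
qed

text \<open>
  A ray from a point \<open>n\<close> of the bisector meets the bisector only in \<open>n\<close>.
\<close>
lemma same_ray:
  assumes n: "len n s = len n t" and u: "len u s \<noteq> len u t"
    and u': "u' \<noteq> n" "bw n u u' \<or> bw n u' u"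
  shows "len u' s \<noteq> len u' t" "\<not> (\<exists>y. len y s = len y t \<and> B u y u')"
proof -
  have c: "col n u u'" using u' col_def bw_sym by metis
  have ne: "u \<noteq> n" using n u by auto
  have off: "len y s \<noteq> len y t" if "y \<noteq> n" "col n u y" for y
    using equidistant_col[of n y u s t] that n u col_rot col_swap by metis
  then show "len u' s \<noteq> len u' t" using u' c by blast
  show "\<not> (\<exists>y. len y s = len y t \<and> B u y u')"
  proof
    assume "\<exists>y. len y s = len y t \<and> B u y u'"
    then obtain y where y: "len y s = len y t" "bw u y u'" "u \<noteq> u'" using B_bw B_irrefl by metis
    have "y \<noteq> n" using u' y ne bw_antisym2 bw_sym by metis
    moreover have "col u u' n" "col u u' y" using c y col_def bw_sym by metis+
    then have "col u n y" using col_line2 y by metis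
    then have "col n u y" by (rule col_swap)
    ultimately show False using off y by blast
  qed
qed

section \<open>Right angles and line reflections\<close>

text \<open>
  The angle \<open>ymn\<close> is right, or degenerate.
\<close>
definition right :: "'a \<Rightarrow> 'a \<Rightarrow> 'a \<Rightarrow> bool" where
  "right y m n \<longleftrightarrow> len y n = len y (reflect m n)"

lemma right_sym: "right a b c \<Longrightarrow> right c b a"
  unfolding right_def using reflect_isometry[of b "reflect b c" a] len_sym by (metis reflect_reflect)

lemma right_col: "right y m n \<Longrightarrow> m \<noteq> n \<Longrightarrow> col m n k \<Longrightarrow> right y m k"
  unfolding right_def
  using five_seg_col[of m n k m "reflect m n" "reflect m k" y y] len_reflect reflect_isometry len_sym by metis

lemma right_self: "right n m n \<Longrightarrow> n = m"
  unfolding right_def using len_null len_sym reflect_eq_self by metis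

text \<open>
  Dropping perpendiculars from \<open>y\<close> to a line is unambiguous. If \<open>n\<close> and \<open>m\<close> were distinct feet, then \<open>y\<close> and its
  reflection \<open>g\<close> in \<open>m\<close> would both be equidistant from \<open>m\<close> and its reflection \<open>f\<close> in \<open>n\<close>; hence so would be \<open>m\<close>, which
  lies on \<open>yg\<close>.
\<close>
lemma right_unique:
  assumes "right y n m" "right y m n"
  shows "m = n"
proof (rule ccontr)
  assume ne: "m \<noteq> n"
  define f g where "f = reflect n m" and "g = reflect m y"
  have f: "len y m = len y f" "f \<noteq> m" "col m n f"
    using assms ne bw_reflect reflect_eq_self unfolding right_def f_def col_def by metis+
  have "len m g = len m y" unfolding g_def by (rule len_reflect)
  moreover have "len n g = len n y"
    using assms(2) reflect_isometry[of m y "reflect m n"] unfolding right_def g_def by (metis len_sym reflect_reflect)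
  ultimately have "len f g = len f y" using equidistant_col[of m n f g y] ne f by metis
  then have g: "len g m = len g f" using f len_sym \<open>len m g = len m y\<close> by metis
  show False
  proof (cases "y = g")
    case True
    then have "y = m" unfolding g_def using reflect_eq_self by metis
    then show False using f len_null len_sym by metis
  next
    case False
    have "col y g m" using bw_reflect[of y m] bw_sym unfolding g_def col_def by blast
    then have "len m m = len m f" using equidistant_col[of y g m m f] False f g by metis
    then show False using f len_null len_sym by metis
  qed
qed

lemma right_bisector:
  assumes "midpoint m c d" "c \<noteq> d" "len y c = len y d" "col c d n"
  shows "right y m n"
proof -
  have "right y m c" using assms reflect_eq unfolding right_def by metis
  moreover have "m \<noteq> c" using assms unfolding midpoint_def by (metis len_null)
  moreover have "col c d m" using assms unfolding midpoint_def col_def using bw_sym by metis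
  then have "col c m n" using col_line2 assms by metis
  then have "col m c n" by (rule col_swap)
  ultimately show ?thesis using right_col by metis
qed

text \<open>
  Here \<open>x, y\<close> and \<open>c, a\<close> are mirror images in the line \<open>qq'\<close>. Let \<open>w\<close> and \<open>m\<close> be the midpoints of \<open>xy\<close> and \<open>ca\<close>, and
  \<open>o'\<close> that of \<open>wm\<close>. The reflection in \<open>o'\<close> takes \<open>xy\<close> to a segment bisected by \<open>m\<close>, just as \<open>ca\<close> is, and the
  reflection in \<open>m\<close> then compares the two; the five-segment axiom leads back to \<open>x\<close> and \<open>y\<close>.
\<close>
lemma line_reflection_isometry:
  assumes q: "q \<noteq> q'" and xy: "x \<noteq> y" "len q x = len q y" "len q' x = len q' y"
    and ca: "c \<noteq> a" "len q c = len q a" "len q' c = len q' a"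
  shows "len x c = len y a"
proof -
  obtain w where w: "midpoint w x y" using ex_midpoint by metis
  obtain m where m: "midpoint m c a" using ex_midpoint by metis
  obtain o' where o: "midpoint o' w m" using ex_midpoint by metis
  have cw: "col q q' w" using bisector_col[of x y q q' w] xy w unfolding midpoint_def by metis
  have cm: "col q q' m" using bisector_col[of c a q q' m] ca m unfolding midpoint_def by metis
  have "col q q' o'"
  proof (cases "w = m")
    case True
    then show ?thesis using o cw bw_aba unfolding midpoint_def by metis
  next
    case False
    have "col w m o'" using o unfolding midpoint_def col_def using bw_sym by metis
    moreover have "col w m q" "col w m q'" using col_line3[of q q' w m] cw cm q col_triv by metis+
    ultimately show ?thesis using col_line3[of w m q q' o'] False by metis
  qed
  then have o_eq: "len o' x = len o' y" "len o' c = len o' a"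
    using equidistant_col[of q q' o'] q xy ca by metis+
  \<comment> \<open>The reflection in the midpoint \<open>o'\<close> of the two feet brings \<open>xy\<close> to a segment with midpoint \<open>m\<close>.\<close>
  define r r' where "r = reflect o' x" and "r' = reflect o' y"
  have "reflect o' w = m" using o reflect_eq by metis
  then have "bw r m r'" "len m r = len m r'"
    using reflect_bw[of x w y o'] reflect_isometry[of o' w x] reflect_isometry[of o' w y] w
    unfolding r_def r'_def midpoint_def by metis+
  then have "reflect m r = r'" "reflect m c = a" using m reflect_eq midpoint_def by metis+
  then have "len r c = len r' a" using reflect_isometry by metis
  moreover have "bw r o' x" "bw r' o' y" unfolding r_def r'_def using bw_reflect bw_sym by metis+
  moreover have "len r o' = len r' o'"
    unfolding r_def r'_def using len_reflect o_eq len_sym by metis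
  moreover have "x \<noteq> o'" using o_eq xy len_null len_sym by metis
  then have "r \<noteq> o'" unfolding r_def by (metis reflect_reflect reflect_self)
  ultimately show ?thesis using five_seg[of r o' x r' o' y c a] o_eq by metis
qed

text \<open>
  A leg of a right triangle is shorter than the hypotenuse. Otherwise \<open>ap\<close> equals the part \<open>an\<close> of the leg \<open>am\<close>.
  Measured along \<open>np\<close>, the angle \<open>pnm\<close> is obtuse: it is exterior to the isosceles triangle \<open>anp\<close>, so that the
  perpendicular \<open>U\<close> to \<open>np\<close> at \<open>n\<close> separates \<open>p\<close> from \<open>m\<close>. Measured along \<open>nm\<close>, it is acute: it belongs to the
  right triangle \<open>nmp\<close>, so that the perpendicular \<open>N\<close> to \<open>nm\<close> at \<open>n\<close> leaves \<open>p\<close> and \<open>m\<close> on one side.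
  The symmetry that exchanges the rays \<open>np\<close> and \<open>nm\<close> exchanges \<open>U\<close> and \<open>N\<close>, a contradiction.
\<close>
lemma leg_less_hypotenuse:
  assumes m: "midpoint m c a" and ca: "c \<noteq> a" and p: "len p c = len p a"
    and n: "bw a n m" "n \<noteq> m" "len a n = len a p"
  shows False
proof -
  have ma: "m \<noteq> a" "m \<noteq> c" and Tm: "bw c m a" using m ca len_null len_sym unfolding midpoint_def by metis+
  have na: "n \<noteq> a" using p n ca len_null len_sym by metis
  have cn: "col c a n" using bw_inner[of c m a] bw_outer[of c m n a] Tm n bw_sym bw_inner2 unfolding col_def by metis
  have rpm: "right p m n" using right_bisector m ca p cn by metis
  have pm: "p \<noteq> m" using equidistant_bw[of m n a] n bw_sym by metis
  have np: "n \<noteq> p" using rpm right_self pm by blast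
  obtain w where w: "midpoint w n p" using ex_midpoint by metis
  then have cw: "col n p w" "bw n w p" "reflect w n = p" "w \<noteq> n" "w \<noteq> p"
    using bw_sym np len_null len_sym reflect_eq unfolding midpoint_def col_def by metis+
  \<comment> \<open>No point of the bisector of \<open>np\<close> lies on the perpendicular to \<open>np\<close> at \<open>n\<close>: both are perpendicular to \<open>np\<close>, at different points.\<close>
  have A: False if "len y n = len y p" "right y n p" for y
    using right_unique[of y n w] right_col[of y n p w] that cw np unfolding right_def by metis
  have off: "\<not> right a n p" "\<not> right w n p" "\<not> right p n p"
    using A n right_col[of w n p w] right_self np cw by metis+
  define p1 where "p1 = reflect n p"
  have p1: "bw p1 n p" "p1 \<noteq> n" "p1 \<noteq> p" unfolding p1_def
    using bw_reflect bw_sym np by (metis reflect_reflect reflect_self reflect_eq_self)+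
  \<comment> \<open>The perpendicular \<open>U\<close> to \<open>np\<close> at \<open>n\<close>, with sides told apart by \<open>P\<close>.\<close>
  have U: "right y n p \<longleftrightarrow> len y p = len y p1" for y unfolding right_def p1_def ..
  obtain P :: "'a \<Rightarrow> bool" where P: "\<And>u v. \<not> right u n p \<Longrightarrow> \<not> right v n p \<Longrightarrow>
      (\<exists>y. right y n p \<and> B u y v) \<longleftrightarrow> P u \<noteq> P v"
    using bisector_sides[of p p1] p1 unfolding U by metis
  have nU: "right n n p" unfolding right_def using len_reflect by metis
  have ray: "\<not> right u' n p \<and> P u = P u'" if "\<not> right u n p" "u' \<noteq> n" "bw n u u' \<or> bw n u' u" for u u'
    using same_ray[of n p p1 u u'] P[of u u'] that nU unfolding U by blast
  \<comment> \<open>\<open>a\<close> and \<open>p\<close> lie on one side of \<open>U\<close>, since the bisector \<open>aw\<close> of \<open>np\<close> does not meet \<open>U\<close>.\<close>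
  have "P a = P w"
  proof -
    have False if "right y n p" "B a y w" for y
    proof -
      have "a \<noteq> w" "col a w y" using that B_irrefl B_bw col_def bw_sym by metis+
      then have "len y n = len y p"
        using equidistant_col[of a w y n p] n w unfolding midpoint_def by metis
      then show False using A that by blast
    qed
    then show ?thesis using P off by blast
  qed
  moreover have "P w = P p" using ray[of w p] off cw np by blast
  moreover have mU: "\<not> right m n p"
  proof
    assume "right m n p"
    then have "right a n p"
      using equidistant_col[of n m a p p1] nU n U col_def bw_sym by metis
    then show False using off by blast
  qed
  moreover have "P a \<noteq> P m" using P[of a m] off mU nU n na B_bw by metis
  ultimately have Ppm: "P p \<noteq> P m" by simp
  \<comment> \<open>\<open>p0\<close> is \<open>p\<close> moved along the ray from \<open>n\<close> such that the triangle \<open>p0 n m\<close> becomes isosceles.\<close>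
  obtain p0 where p0: "bw p1 n p0" "len n p0 = len n m" using ext p1 by metis
  have p0n: "p0 \<noteq> n" using p0 n len_null by metis
  have p0ray: "bw n p p0 \<or> bw n p0 p" using bw_conn2[of p1 n p p0] p1 p0 by blast
  then have "\<not> right p0 n p" "P p0 \<noteq> P m" using ray[of p p0] off p0n Ppm by auto
  \<comment> \<open>So \<open>U\<close> crosses the base of that triangle. The symmetry of the triangle takes the crossing to \<open>v'\<close>.\<close>
  then obtain v where v: "right v n p" "B p0 v m" using P[of p0 m] mU by blast
  have "col n p p0" using p0ray col_def bw_sym by metis
  then have v0: "right v n p0" using v right_col np by metis
  obtain o' where o: "midpoint o' p0 m" using ex_midpoint by metis
  have p0m: "p0 \<noteq> m" using v B_irrefl by metis
  have o0: "reflect o' p0 = m" "o' \<noteq> p0" using o p0m reflect_eq len_null len_sym unfolding midpoint_def by metis+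
  define v' where "v' = reflect o' v"
  have "right n o' p0" unfolding right_def using o0 p0 by simp
  moreover have "col o' p0 v"
  proof -
    have "col p0 m o'" "col p0 m v" using o v bw_sym B_bw unfolding midpoint_def col_def by metis+
    then show ?thesis using col_line2[of p0 m o' v] p0m col_swap by metis
  qed
  ultimately have "right n o' v" using right_col o0 by metis
  then have nv: "len n v = len n v'" unfolding right_def v'_def .
  define s t where "s = reflect n p0" and "t = reflect n m"
  have "len p0 v = len m v'" unfolding v'_def using reflect_isometry o0 by metis
  moreover have "len s v = len t v'"
    using five_seg[of p0 n s m n t v v'] p0n p0 bw_reflect len_reflect calculation nv len_sym
    unfolding s_def t_def by metis
  ultimately have v'N: "right v' n m" using v0 unfolding right_def s_def t_def using len_sym by metis
  have Tv': "bw p0 v' m" using reflect_bw[of m v p0 o'] v B_bw bw_sym o0 unfolding v'_def by (metis reflect_reflect)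
  have mt: "m \<noteq> t" unfolding t_def using n reflect_eq_self by metis
  \<comment> \<open>The perpendicular \<open>N\<close> to \<open>nm\<close> at \<open>n\<close>, with sides told apart by \<open>Q\<close>.\<close>
  have N: "right y n m \<longleftrightarrow> len y m = len y t" for y unfolding right_def t_def ..
  obtain Q :: "'a \<Rightarrow> bool" where Q: "\<And>u v. \<not> right u n m \<Longrightarrow> \<not> right v n m \<Longrightarrow>
      (\<exists>y. right y n m \<and> B u y v) \<longleftrightarrow> Q u \<noteq> Q v"
    using bisector_sides[of m t] mt unfolding N by metis
  have nN: "right n n m" unfolding right_def using len_reflect by metis
  have offN: "\<not> right m n m" "\<not> right p n m" using right_self right_unique rpm n by metis+
  \<comment> \<open>\<open>N\<close> and the line \<open>pm\<close> are both perpendicular to \<open>nm\<close>, hence do not meet.\<close>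
  have "Q p = Q m"
  proof -
    have False if "right y n m" "B p y m" for y
    proof -
      have "p \<noteq> m" "col p m y" using that B_irrefl B_bw col_def bw_sym by metis+
      then have "len y c = len y a"
        using equidistant_col[of p m y c a] p m unfolding midpoint_def by metis
      then have "right y m n" using right_bisector m ca cn by metis
      then show False using right_unique that n by metis
    qed
    then show ?thesis using Q offN by blast
  qed
  moreover have p0N: "\<not> right p0 n m" and "Q p = Q p0"
    using same_ray[of n m t p p0] Q[of p p0] nN offN p0n p0ray unfolding N by blast+
  moreover have "B p0 v' m" using Tv' v'N offN p0N B_bw by metis
  then have "Q p0 \<noteq> Q m" using Q[of p0 m] p0N offN v'N by blast
  ultimately show False by simp
qed

lemma inside_misses_perpendicular:
  assumes m: "midpoint m c a" "c \<noteq> a" and n: "bw a n m" "n \<noteq> m" "len a n = len a x"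
    and p: "len p c = len p a" "bw a p x"
  shows False
proof -
  obtain k where k: "bw a k n" "len a p = len a k" using bw_copy p n by metis
  have "bw a k m" "k \<noteq> m" using k n bw_inner2 bw_aba by metis+
  then show False using leg_less_hypotenuse m p k by metis
qed

text \<open>
  A ray from a point of the line \<open>uv\<close> stays on one side of that line.
\<close>
lemma left_ray:
  assumes L: "L u v w" and o: "on o' u v" and w: "B o' w w' \<or> B o' w' w"
  shows "L u v w'"
proof -
  have uv: "u \<noteq> v" "\<not> on w u v" using L L_off by blast+
  have c: "col o' w w'" "o' \<noteq> w'" "o' \<noteq> w" "w \<noteq> w'" using w B_bw col_def bw_sym B_irrefl by metis+
  have no: False if "on p u v" "p \<noteq> o'" "col o' w p" for p
  proof -
    have "col o' p u" "col o' p v"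
      using col_line3[of u v o' p] that(1) o uv col_triv on_col by metis+
    moreover have "col o' p w" using that col_rot col_swap by metis
    ultimately have "col u v w" using col_line3[of o' p u v w] that by metis
    then show False using uv on_col by metis
  qed
  have "\<not> on w' u v" using no c by metis
  moreover have False if "on p u v" "B w p w'" for p
  proof -
    have "p \<noteq> o'" using that w B_bw bw_antisym2 bw_sym by metis
    moreover have "col w w' p" "col w w' o'" using that c B_bw col_def bw_sym by metis+
    then have "col w o' p" using col_line2 c by metis
    ultimately show False using no that col_swap by metis
  qed
  ultimately show ?thesis using L_same L by metis
qed

section \<open>Intersections of lines and circles\<close>

text \<open>
  Together with \<open>bw_last_point\<close>: the last intersection of \<open>Line(u,v)\<close> with a circle about \<open>v\<close> is the point that
  extends \<open>uv\<close> by the radius. The comparison is with that extension, which always exists.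
\<close>
lemma last_point_bw:
  assumes uv: "u \<noteq> v" and z: "C v z p r"
    and last: "\<And>w. on w u v \<Longrightarrow> C v w p r \<Longrightarrow> precedes B u v w z"
  shows "bw u v z"
proof -
  obtain w where w: "bw u v w" "C v w p r" using ex_ext uv by blast
  show ?thesis
  proof (cases "w = v")
    case True
    then have "z = v" using w z C_len len_null len_sym by metis
    then show ?thesis by simp
  next
    case False
    have "on w u v" using w uv on_col col_def by metis
    then have "precedes B u v w z" using last w by blast
    moreover have "\<not> bw w u v" using w False bw_sym bw_antisym bw_antisym2 uv by metis
    ultimately have "bw u w z" unfolding precedes_def by blast
    then show ?thesis using w bw_inner2 by blast
  qed
qed

text \<open>
  The line through the centers bisects the segment between two common points; distinct common points are
  therefore on opposite sides of it.
\<close>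
lemma left_circles_unique:
  assumes cd: "c \<noteq> d" and u: "len c u = len c u'" "len d u = len d u'"
    and L: "\<not> L d c u" "\<not> L d c u'"
  shows "u = u'"
proof (rule ccontr)
  assume ne: "u \<noteq> u'"
  obtain w where w: "midpoint w u u'" using ex_midpoint by metis
  have off: "\<not> on v c d" if "len c v = len c v'" "len d v = len d v'" "v \<noteq> v'" for v v'
    using equidistant_col[of c d v v v'] that cd on_col len_null by metis
  then have "L c d u" "\<not> on u' c d" using L_total[OF cd] L u ne by metis+
  moreover have "on w c d"
    using bisector_col[of u u' c d w] ne u w cd on_col unfolding midpoint_def by metis
  moreover have "B u w u'" using w ne B_bw len_null len_sym unfolding midpoint_def by metis
  ultimately show False using L_opposite L by blast
qed

lemma left_apexes_distinct:
  assumes ca: "c \<noteq> a" and q: "C c q c a" "C a q c a" "\<not> L a c q"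
    and q': "C a q' a c" "C c q' a c" "\<not> L c a q'"
  shows "L c a q" "L a c q'" "q \<noteq> q'"
proof -
  show "L c a q" "L a c q'"
    using apex_left[of c a q] apex_left[of a c q'] ca q q' C_len len_sym by metis+
  then show "q \<noteq> q'" using L_asym by blast
qed

lemma bw_last_point:
  assumes uv: "u \<noteq> v" and z: "bw u v z" "C v z p r" and w: "on w u v" "C v w p r"
  shows "precedes B u v w z"
proof (cases "bw u v w")
  case True
  then have "w = z" using ext_unique uv z w C_len by metis
  then show ?thesis unfolding precedes_def using True by simp
next
  case False
  then have c: "bw v w u \<or> bw w u v" using w uv on_col bw_sym unfolding col_def by metis
  have "\<not> B z w v"
    using equidistant_bw[of z w v] z w C_len B_bw by metis
  moreover have "bw u w z" if "\<not> bw w u v"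
    using c that z bw_inner2 bw_sym by metis
  ultimately show ?thesis unfolding precedes_def using False by blast
qed

end

section \<open>The construction of the reflection in a model\<close>

text \<open>
  The line \<open>ab\<close> is prolonged beyond \<open>a\<close> by \<open>ab\<close> to \<open>a0\<close> and by \<open>ax\<close> to \<open>m\<close>, so that \<open>m\<close> is farther from \<open>a\<close> than \<open>x\<close> is.
  The points \<open>q\<close> and \<open>q'\<close> span the perpendicular \<open>Q\<close> to \<open>ab\<close> at \<open>m\<close>, the midpoint of \<open>ca\<close>, and \<open>y\<close> is the intersection of
  the circles about \<open>q\<close> and \<open>q'\<close> through \<open>x\<close> that is not on the side of \<open>a\<close>.
\<close>
locale reflection_construction = geometry +
  fixes a b x a0 m c q q' y
  assumes ab: "a \<noteq> b"
    and a0: "bw b a a0" "C a a0 a b"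
    and m: "bw a a0 m" "C a0 m a x"
    and c: "bw a m c" "C m c m a"
    and q: "C c q c a" "C a q c a" "\<not> L a c q"
    and q': "C a q' a c" "C c q' a c" "\<not> L c a q'"
    and y: "C q' y q' x" "C q y q x" "\<not> L q q' y"
begin

lemma a_a0: "a \<noteq> a0" using a0 ab C_len len_null by metis
lemma a_m: "a \<noteq> m" using m a_a0 bw_aba by metis
lemma c_a: "c \<noteq> a" using c a_m bw_aba by metis

lemma midpoint_m: "midpoint m c a"
  unfolding midpoint_def using c bw_sym C_len len_sym by metis

lemma lens: "len c q = len a q" "len c q' = len a q'" "len q x = len q y" "len q' x = len q' y"
  using q q' y C_len by metis+

lemma q_left: "L c a q" and q_q': "q \<noteq> q'"
  using left_apexes_distinct c_a q q' by blast+

lemma q_off: "\<not> col c a q" using q_left L_off c_a on_col by blast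

lemma m_between: "B q m q'"
proof -
  have "col c a m" using midpoint_m bw_sym unfolding midpoint_def col_def by blast
  then have l: "len m q = len m q'" "m \<noteq> q"
    using equidistant_col[of c a m q q'] c_a q q' q_off C_len len_sym by metis+
  moreover have "col q q' m"
    using bisector_col[of c a q q' m] c_a midpoint_m lens len_sym unfolding midpoint_def by metis
  ultimately have "bw q m q'" using equidistant_between q_q' by metis
  then show ?thesis using l B_bw len_null by metis
qed

text \<open>
  \<open>a\<close> and \<open>x\<close> are on the same side of \<open>Q\<close>, because \<open>ax\<close> is too short to reach \<open>Q\<close>. That \<open>a\<close> is on the left
  of the line directed from \<open>q\<close> to \<open>q'\<close> follows from \<open>q\<close> being on the left of that from \<open>c\<close> to \<open>a\<close>, turning triangles cyclically and
  moving vertices along rays.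
\<close>
lemma x_side: "L q q' x"
proof -
  have "B a m c" using c a_m B_bw C_len len_null len_sym by metis
  moreover have "L a q c" "on a a q" using q_left L_cyclic on_def by blast+
  ultimately have "L a q m" using left_ray by blast
  then have "L m a q" using L_cyclic by blast
  then have "L a q m" "L q m a" using L_cyclic by blast+
  moreover have "on q a q" using on_def by blast
  ultimately have "L a q q'" using left_ray m_between by blast
  then have a: "L q q' a" using L_cyclic by blast
  obtain o' where "midpoint o' a m" using ex_midpoint by metis
  then have o: "reflect o' a = m" "reflect o' m = a" using reflect_eq midpoint_sym by metis+
  \<comment> \<open>\<open>m\<close> was obtained by laying off \<open>ab\<close> and then \<open>ax\<close> from \<open>a\<close>. In the other order, \<open>ax\<close> ends at \<open>n\<close>, properly before \<open>m\<close>.\<close>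
  define n where "n = reflect o' a0"
  have n: "bw a n m" "n \<noteq> m" "len a n = len a x"
    using reflect_bw[of a a0 m o'] reflect_isometry[of o' m a0] m o a_a0 bw_sym C_len len_sym
    unfolding n_def by (metis reflect_reflect)+
  have out: False if "on p q q'" "bw a p x" for p
  proof -
    have "len p c = len p a"
      using that on_bisector[of c a q q' p] c_a q_q' lens len_sym by metis
    then show False using inside_misses_perpendicular midpoint_m c_a n that by metis
  qed
  then show ?thesis using L_same[OF a, of x] B_bw bw_right by metis
qed

lemma x_y: "x \<noteq> y" using x_side y by blast

text \<open>
  \<open>y\<close> is not even on \<open>Q\<close>: there the two circles would touch, at \<open>x\<close>.
\<close>
lemma y_m: "y \<noteq> m"
proof
  assume "y = m"
  then have "col q q' y" using m_between B_bw bw_sym col_def by metis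
  then have "len y x = len y y" using equidistant_col q_q' lens by metis
  then show False using x_y len_null by metis
qed

text \<open>
  \<open>z\<close> is as far from \<open>c\<close> as \<open>y\<close> is from \<open>a\<close> (reflection in \<open>m\<close>), which is as far as \<open>x\<close> is from \<open>c\<close> (reflection in \<open>Q\<close>);
  likewise for \<open>a\<close>. If \<open>x\<close> is on the line \<open>ca\<close>, these distances force \<open>z = x\<close>. If not, then \<open>z \<noteq> x\<close>, and the midpoint
  of \<open>xz\<close> is the foot of the perpendicular from \<open>x\<close>, which is \<open>e\<close>.
\<close>
lemma value_is_mirror_image:
  assumes z: "bw y m z" "C m z m y"
    and K: "k \<noteq> l" "on m0 k l" "on m0 a b" "p0 \<noteq> m0" "on p0 k l" "on q0 a b" "on r0 a b"
      "B q0 m0 r0" "C p0 q0 p0 r0" "C q0 m0 m0 r0"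
    and x: "on x k l" and e: "on e k l" "on e a b"
  shows "on z k l \<and> C e z e x \<and> (\<not> on x a b \<longrightarrow> B x e z)"
proof -
  have "midpoint m y z" using z C_len len_sym unfolding midpoint_def by metis
  moreover have "col c a m" using midpoint_m bw_sym unfolding midpoint_def col_def by metis
  then have "len m q = len m q'"
    using equidistant_col[of c a m q q'] c_a q(1,2) q'(1,2) C_len len_sym by metis
  then have "midpoint m q q'" using m_between B_bw unfolding midpoint_def by metis
  ultimately have rz: "reflect m y = z" "reflect m c = a" "reflect m a = c" "reflect m q = q'"
    using midpoint_m midpoint_sym reflect_eq by metis+
  have "len x c = len y a" "len x a = len y c"
    using line_reflection_isometry[of q q' x y] q_q' x_y lens c_a len_sym by metis+
  then have cz: "len c x = len c z" "len a x = len a z"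
    using reflect_isometry[of m a y] reflect_isometry[of m c y] rz len_sym by metis+
  have line: "on w a b \<longleftrightarrow> col c a w" for w
  proof -
    have "col a b a0" using a0 col_def bw_sym by metis
    moreover have "col a a0 m" using m col_def by metis
    ultimately have "col a b m" using col_line3[of a a0 a b m] a_a0 col_rot col_swap col_triv by metis
    moreover have "col a m c" using c col_def by metis
    ultimately have "col a b c" using col_line3[of a m a b c] a_m col_rot col_swap col_triv by metis
    then show ?thesis
      using col_line3[of a b c a w] col_line3[of c a a b w] ab c_a on_col col_rot col_swap col_triv by metis
  qed
  show ?thesis
  proof (cases "on x a b")
    case True
    then have "len x x = len x z" using equidistant_col[of c a x x z] c_a cz line by metis
    then have "x = z" using len_null by metis
    then show ?thesis using True x C_len by metis
  next
    case False
    have xz: "x \<noteq> z"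
    proof
      assume "x = z"
      then have "len q x = len q' y" using reflect_isometry[of m q' y] rz reflect_reflect by metis
      then have "len x q = len x q'" using lens len_sym by metis
      then have "col c a x" using bisector_col[of q q' c a x] q_q' lens(1,2) q q' C_len len_sym by metis
      then show False using False line by metis
    qed
    obtain w where w: "midpoint w x z" using ex_midpoint by metis
    then have rw: "reflect w x = z" using reflect_eq by metis
    have "col c a w" using bisector_col[of x z c a w] xz cz w unfolding midpoint_def by metis
    then have wL: "on w a b" using line by metis
    have kl: "col k l u \<longleftrightarrow> on u k l" for u using K on_col by metis
    have abl: "col a b u \<longleftrightarrow> on u a b" for u using ab on_col by metis
    \<comment> \<open>Two distinct common points would make the perpendicular coincide with \<open>ab\<close>.\<close>
    have "e = m0"
    proof (rule ccontr)
      assume ne: "e \<noteq> m0"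
      have "col e m0 x" using col_line3[of k l e m0 x] K x e kl by metis
      moreover have "col e m0 a" "col e m0 b"
        using col_line3[of a b e m0] ab K e abl col_triv by metis+
      ultimately have "col a b x" using col_line3[of e m0 a b x] ne by metis
      then show False using False abl by metis
    qed
    then have me: "midpoint e q0 r0" and qr: "q0 \<noteq> r0"
      using K B_bw B_irrefl C_len len_sym unfolding midpoint_def by metis+
    have "col p0 e x" using col_line3[of k l p0 e x] K x e kl by metis
    then have "len x q0 = len x r0"
      using equidistant_col[of p0 e x q0 r0] K \<open>e = m0\<close> me C_len unfolding midpoint_def by metis
    moreover have "col q0 r0 w" using col_line3[of a b q0 r0 w] ab K wL abl by metis
    ultimately have "right x e w" using right_bisector me qr by metis
    moreover have "len e x = len e z" using equidistant_col[of c a e x z] c_a cz line e by metis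
    then have "right x w e" using right_sym[of e w x] rw unfolding right_def by metis
    ultimately have "e = w" using right_unique by metis
    then have xez: "bw x e z" "len e x = len e z" using w unfolding midpoint_def by blast+
    have "e \<noteq> x" using e False by metis
    then have "B x e z" using xez B_bw len_null by metis
    moreover have "col x e z" using xez col_def by metis
    moreover have "col x e k" "col x e l" using col_line3[of k l x e] K x e kl col_triv by metis+
    ultimately have "col k l z" using col_line3[of x e k l z] \<open>e \<noteq> x\<close> by metis
    then show ?thesis using \<open>B x e z\<close> xez kl C_len by metis
  qed
qed

end

section \<open>Derivability from classical validity\<close>

lemma sub_notions [simp]:
  "sub s (T a b c) = T (sub_pt s a) (sub_pt s b) (sub_pt s c)"
  "sub s (On a b c) = On (sub_pt s a) (sub_pt s b) (sub_pt s c)"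
  "sub s (Col a b c) = Col (sub_pt s a) (sub_pt s b) (sub_pt s c)"
  "sub s (Le a b c d) = Le (sub_pt s a) (sub_pt s b) (sub_pt s c) (sub_pt s d)"
  "sub s (Precedes a b c d) = Precedes (sub_pt s a) (sub_pt s b) (sub_pt s c) (sub_pt s d)"
  by (simp_all add: T_def On_def Col_def Le_def Precedes_def Let_def numeral_eq_Suc)

lemma stable_fm_notions [simp]: "stable_fm (T a b c)" "stable_fm (On x a b)" "stable_fm (Precedes a b u v)"
  by (simp_all add: T_def On_def Precedes_def)

lemma stable_foralls_notions [simp]:
  "stable_foralls (T a b c)" "stable_foralls (On x a b)" "stable_foralls (Precedes a b u v)" "stable_foralls (Col a b c)" "stable_foralls (Le a b c d)"
  "stable_foralls (Perp k l a b)"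
  by (simp_all add: T_def On_def Precedes_def Col_def Le_def Perp_def Perp_at_def Let_def)

abbreviation (input) Ax :: "fm set" where "Ax \<equiv> neutral \<union> handedness"

lemma Ax_closed: "substitution_closed Ax"
proof -
  have "sub s A \<in> neutral" if "A \<in> neutral" for A s
    using that by cases (simp_all add: Let_def neutral.intros[unfolded Let_def, simplified])
  moreover have "sub s A \<in> handedness" if "A \<in> handedness" for A s
    using that by cases (simp_all add: Let_def handedness.intros[unfolded Let_def, simplified])
  ultimately show ?thesis unfolding substitution_closed_def by blast
qed

lemma Ax_stable: "has_stability Ax"
  unfolding has_stability_def by (auto intro: neutral.intros handedness.intros)

lemma Ax_stable_foralls: "A \<in> Ax \<Longrightarrow> stable_foralls A"
  by (auto elim!: neutral.cases handedness.cases simp: Let_def)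

lemma case_nat_pt_val_up [simp]: "pt_val F (case_nat d e) (up (Suc n) p) = pt_val F e (up n p)"
  by (cases p) auto

lemma case_nat_pt_val_up_numeral [simp]:
  "pt_val F (case_nat d e) (up (numeral n) p) = pt_val F e (up (pred_numeral n) p)"
  by (simp add: numeral_eq_Suc)

lemma sat_notions [simp]:
  "sat B C L F e (T a b c) \<longleftrightarrow> weakly_between B (pt_val F e a) (pt_val F e b) (pt_val F e c)"
  "sat B C L F e (On x a b) \<longleftrightarrow> on_line B (pt_val F e x) (pt_val F e a) (pt_val F e b)"
  "sat B C L F e (Precedes a b u v) \<longleftrightarrow>
     precedes B (pt_val F e a) (pt_val F e b) (pt_val F e u) (pt_val F e v)"
  "sat B C L F e (Col a b c) \<longleftrightarrow> (\<exists>p q. p \<noteq> q \<and> on_line B (pt_val F e a) p q \<and>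
     on_line B (pt_val F e b) p q \<and> on_line B (pt_val F e c) p q)"
  "sat B C L F e (Le a b c d) \<longleftrightarrow> (\<exists>y. weakly_between B (pt_val F e c) y (pt_val F e d) \<and>
     C (pt_val F e a) (pt_val F e b) (pt_val F e c) y)"
  subgoal by (auto simp: T_def weakly_between_def)
  subgoal by (auto simp: On_def on_line_def)
  subgoal by (auto simp: Precedes_def precedes_def T_def weakly_between_def)
  subgoal by (auto simp: Col_def Let_def On_def on_line_def)
  subgoal by (auto simp: Le_def Let_def T_def weakly_between_def)
  done

lemma geometry_model:
  assumes M: "\<And>A e. A \<in> Ax \<Longrightarrow> sat B C L F e A"
  shows "geometry B C L"
proof -
  have N: "sat B C L F e A" if "A \<in> neutral" for A e using M that by blast
  have H: "sat B C L F e A" if "A \<in> handedness" for A e using M that by blast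
  define env where "env = (\<lambda>(xs :: 'a list) n. xs ! n)"
  note [simp] = Let_def
  show ?thesis
  proof
    fix a b c d p q r s a' b' c' p' u v
    show "C a b b a" using N[OF neutral.cong_swap[of "Var 0" "Var 1"], of "env [a, b]"] by (simp add: env_def)
    show "C a b p q \<Longrightarrow> C a b r s \<Longrightarrow> C p q r s"
      using N[OF neutral.cong_trans[of "Var 0" "Var 1" "Var 2" "Var 3" "Var 4" "Var 5"], of "env [a, b, p, q, r, s]"]
      by (simp add: env_def)
    show "C a b c c \<Longrightarrow> a = b"
      using N[OF neutral.cong_null[of "Var 0" "Var 1" "Var 2"], of "env [a, b, c]"] by (simp add: env_def)
    show "a \<noteq> b \<Longrightarrow> \<exists>x. weakly_between B a b x \<and> C b x c d"
      using N[OF neutral.extension[of "Var 0" "Var 1" "Var 2" "Var 3"], of "env [a, b, c, d]"] by (simp add: env_def)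
    show "a \<noteq> b \<Longrightarrow> weakly_between B a b c \<Longrightarrow> weakly_between B a' b' c' \<Longrightarrow> C a b a' b' \<Longrightarrow>
        C b c b' c' \<Longrightarrow> C a p a' p' \<Longrightarrow> C b p b' p' \<Longrightarrow> C c p c' p'"
      using N[OF neutral.five_segment[of "Var 0" "Var 1" "Var 2" "Var 3" "Var 4" "Var 5" "Var 6" "Var 7"],
          of "env [a, b, c, a', b', c', p, p']"] by (simp add: env_def)
    show "B a b c \<Longrightarrow> B c b a" "B a b c \<Longrightarrow> a \<noteq> b"
      using N[OF neutral.bet_sym[of "Var 0" "Var 1" "Var 2"], of "env [a, b, c]"] by (auto simp: env_def)
    show "\<not> B a b a" using N[OF neutral.bet_irrefl[of "Var 0" "Var 1"], of "env [a, b]"] by (simp add: env_def)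
    show "weakly_between B a b d \<Longrightarrow> weakly_between B b c d \<Longrightarrow> weakly_between B a b c \<and> weakly_between B a c d"
      using N[OF neutral.inner_trans[of "Var 0" "Var 1" "Var 3" "Var 2"], of "env [a, b, c, d]"] by (simp add: env_def)
    show "weakly_between B a b c \<Longrightarrow> weakly_between B b c d \<Longrightarrow> b \<noteq> c \<Longrightarrow>
        weakly_between B a c d \<and> weakly_between B a b d"
      using N[OF neutral.outer_trans[of "Var 0" "Var 1" "Var 2" "Var 3"], of "env [a, b, c, d]"] by (simp add: env_def)
    show "B a b c \<Longrightarrow> B a b d \<Longrightarrow> weakly_between B a c d \<or> weakly_between B a d c"
      using N[OF neutral.bet_connect[of "Var 0" "Var 1" "Var 2" "Var 3"], of "env [a, b, c, d]"] by (auto simp: env_def)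
    show "p \<noteq> q \<Longrightarrow> C a p a q \<Longrightarrow> C b p b q \<Longrightarrow> C c p c q \<Longrightarrow>
        \<exists>u v. u \<noteq> v \<and> on_line B a u v \<and> on_line B b u v \<and> on_line B c u v"
      using N[OF neutral.upper_dim[of "Var 0" "Var 1" "Var 2" "Var 3" "Var 4"], of "env [p, q, a, b, c]"] by (simp add: env_def)
    show "c \<noteq> d \<Longrightarrow> C c u p q \<Longrightarrow> C c v p q \<Longrightarrow> \<exists>e. weakly_between B r e s \<and> C d u r e \<Longrightarrow>
        \<exists>e. weakly_between B d e v \<and> C r s d e \<Longrightarrow> \<exists>x. C c x p q \<and> C d x r s"
      using N[OF neutral.circle_circle[of "Var 0" "Var 1" "Var 2" "Var 3" "Var 4" "Var 5" "Var 6" "Var 7"],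
          of "env [c, d, u, p, q, v, r, s]"] by (simp add: env_def)
    show "L a b c \<Longrightarrow> a \<noteq> b \<and> \<not> on_line B c a b"
      using H[OF handedness.left_off_line[of "Var 0" "Var 1" "Var 2"], of "env [a, b, c]"] by (simp add: env_def)
    show "L a b c \<Longrightarrow> \<not> L b a c"
      using H[OF handedness.left_asym[of "Var 0" "Var 1" "Var 2"], of "env [a, b, c]"] by (simp add: env_def)
    show "a \<noteq> b \<Longrightarrow> \<not> on_line B c a b \<Longrightarrow> L a b c \<or> L b a c"
      using H[OF handedness.left_total[of "Var 0" "Var 1" "Var 2"], of "env [a, b, c]"] by (auto simp: env_def)
    show "L a b c \<Longrightarrow> L b c a"
      using H[OF handedness.left_cyclic[of "Var 0" "Var 1" "Var 2"], of "env [a, b, c]"] by (simp add: env_def)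
    show "L a b c \<Longrightarrow> \<not> on_line B d a b \<Longrightarrow> \<not> (\<exists>p. on_line B p a b \<and> B c p d) \<Longrightarrow> L a b d"
      using H[OF handedness.left_same_side[of "Var 0" "Var 1" "Var 2" "Var 3"], of "env [a, b, c, d]"] by (simp add: env_def)
    show "L a b c \<Longrightarrow> on_line B p a b \<Longrightarrow> B c p d \<Longrightarrow> L b a d"
      using H[OF handedness.left_opposite_side[of "Var 0" "Var 1" "Var 2" "Var 3" "Var 4"], of "env [a, b, c, p, d]"] by (simp add: env_def)
    show "c \<noteq> d \<Longrightarrow> C c u p q \<Longrightarrow> C d u r s \<Longrightarrow> \<exists>z. C c z p q \<and> C d z r s \<and> \<not> L d c z"
      using H[OF handedness.left_intersection[of "Var 0" "Var 1" "Var 2" "Var 3" "Var 4" "Var 5" "Var 6"],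
          of "env [c, d, u, p, q, r, s]"] by (simp add: env_def)
  qed
qed

text \<open>
  A ray contains infinitely many points: starting from a fixed point, extend again and again, and use that
  betweenness orders the ray.
\<close>
lemma ex_distinct_points:
  assumes "complete_theory Ax Th"
  shows "\<exists>t :: nat \<Rightarrow> pt. \<forall>i j. i < j \<longrightarrow> \<not> Th (t i \<^bold>= t j)"
proof -
  interpret complete_theory Ax Th by (rule assms)
  have N: "Th A" if "A \<in> neutral" for A using Th_axiom that by blast
  have H: "Th A" if "A \<in> handedness" for A using Th_axiom that by blast
  let ?o = "Fix Alpha"
  define W where "W a b c \<longleftrightarrow> Th (T a b c)" for a b c
  have W: "W a b c \<longleftrightarrow> Th (a \<^bold>= b) \<or> Th (b \<^bold>= c) \<or> Th (Bet a b c)" for a b c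
    unfolding W_def by (auto simp: T_def)
  have sym: "Th (Bet a b c) \<Longrightarrow> Th (Bet c b a) \<and> \<not> Th (a \<^bold>= b) \<and> \<not> Th (b \<^bold>= c)" for a b c
    using N[OF neutral.bet_sym[of a b c]] by simp
  have irr: "\<not> Th (Bet a b a)" for a b using N[OF neutral.bet_irrefl[of a b]] by simp
  have inner: "W a b d \<Longrightarrow> W b c d \<Longrightarrow> W a b c \<and> W a c d" for a b c d
    using N[OF neutral.inner_trans[of a b d c]] by (simp add: W_def)
  have trans: "Th (Bet a b d)" if "Th (Bet a b c)" "Th (Bet a c d)" for a b c d
  proof -
    have "W d c a" "W c b a" using that sym W by blast+
    then have *: "W d c b" "W d b a" using inner by blast+
    have "\<not> Th (d \<^bold>= b)"
    proof
      assume db: "Th (d \<^bold>= b)"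
      then have "Th (Bet a c b)" using Th_Bet_subst[OF Th_Eq_refl Th_Eq_refl db] that by blast
      then have "W b c a" using sym W by blast
      then have "W b c b" using inner[of b c a b] \<open>W c b a\<close> by blast
      then show False using irr[of b c] sym[OF that(1)] Th_Eq_sym W by blast
    qed
    moreover have "\<not> Th (b \<^bold>= a)" using sym[OF that(1)] Th_Eq_sym by blast
    ultimately show ?thesis using * W sym by blast
  qed
  have next_pt: "\<exists>z. Th (Bet a b z)" if ab: "\<not> Th (a \<^bold>= b)" for a b
  proof -
    obtain z where z: "W a b z" "Th (Cong b z a b)"
      using N[OF neutral.extension[of a b a b]] ab by (auto simp: W_def inst_def Let_def)
    have "\<not> Th (b \<^bold>= z)"
    proof
      assume "Th (b \<^bold>= z)"
      then have bb: "Th (Cong b b a b)"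
        using Th_Cong_subst[OF Th_Eq_refl Th_Eq_sym Th_Eq_refl Th_Eq_refl z(2)] by blast
      have "Th (Cong b b b b)" using N[OF neutral.cong_swap] by blast
      then have "Th (Cong a b b b)" using N[OF neutral.cong_trans[of b b a b b b]] bb by simp
      then show False using N[OF neutral.cong_null[of a b b]] ab by simp
    qed
    then show ?thesis using z W ab by blast
  qed
  have "\<exists>t. \<forall>n. \<not> Th (?o \<^bold>= t n) \<and> Th (Bet ?o (t n) (t (Suc n)))"
  proof (rule dependent_nat_choice)
    show "\<exists>x. \<not> Th (?o \<^bold>= x)"
      using H[OF handedness.left_fixed] H[OF handedness.left_off_line[of "Fix Alpha" "Fix Beta" "Fix Gamma"]] by auto
  next
    fix x n assume "\<not> Th (?o \<^bold>= x)"
    then obtain z where z: "Th (Bet ?o x z)" using next_pt by blast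
    then have "Th (Bet z x ?o)" using sym by blast
    have "\<not> Th (?o \<^bold>= z)"
    proof
      assume "Th (?o \<^bold>= z)"
      then have "Th (Bet ?o x ?o)" using Th_Bet_subst[OF Th_Eq_refl Th_Eq_refl Th_Eq_sym z] by blast
      then show False using irr by blast
    qed
    with z show "\<exists>y. \<not> Th (?o \<^bold>= y) \<and> Th (Bet ?o x y)" by blast
  qed
  then obtain t where t: "\<And>n. Th (Bet ?o (t n) (t (Suc n)))" by blast
  have "Th (Bet ?o (t i) (t j))" if "i < j" for i j
    using that by (induction rule: strict_inc_induct) (use t trans in blast)+
  then show ?thesis using sym by blast
qed

text \<open>
  The bridge between the two logics. If a stable formula \<open>A\<close> is not derivable from \<open>H\<close>, then its negation is
  consistent with \<open>H\<close>, and the term model of a complete theory containing both is a classical geometry in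
  which \<open>A\<close> fails.
\<close>
lemma derivable_if_valid:
  assumes H: "finite H" "\<forall>h\<in>H. stable_foralls h" and A: "stable_foralls A" "stable_fm A"
    and valid: "\<And>(B :: nat \<Rightarrow> nat \<Rightarrow> nat \<Rightarrow> bool) C L F e. geometry B C L \<Longrightarrow>
      \<forall>h\<in>H. sat B C L F e h \<Longrightarrow> sat B C L F e A"
  shows "Ax; H \<turnstile> A"
proof (rule ccontr)
  assume "\<not> (Ax; H \<turnstile> A)"
  then have con: "\<not> (Ax; insert (\<^bold>\<not> A) H \<turnstile> \<^bold>\<bottom>)"
    using stable_fm_dn_elim[OF Ax_closed Ax_stable A(2)] by (auto intro: ImpI)
  obtain Th where Th: "complete_theory Ax Th" "\<And>h. h \<in> insert (\<^bold>\<not> A) H \<Longrightarrow> Th h"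
    using ex_complete_theory[OF Ax_closed Ax_stable _ con] H(1) by auto
  interpret complete_theory Ax Th by (rule Th(1))
  obtain t :: "nat \<Rightarrow> pt" where t: "\<And>i j. i < j \<Longrightarrow> \<not> Th (t i \<^bold>= t j)"
    using ex_distinct_points[OF Th(1)] by blast
  obtain B C L F e where M: "\<And>A. stable_foralls A \<Longrightarrow> Th A \<Longrightarrow> sat B C L F (e :: nat \<Rightarrow> nat) A"
      "\<And>A e. A \<in> Ax \<Longrightarrow> stable_foralls A \<Longrightarrow> sat B C L F e A"
    using ex_model[of t, OF t] by blast
  have "geometry B C L" using geometry_model M(2) Ax_stable_foralls by blast
  moreover have "\<forall>h\<in>H. sat B C L F e h" using M(1) H(2) Th(2) by blast
  ultimately have "sat B C L F e A" by (rule valid)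
  moreover have "sat B C L F e (\<^bold>\<not> A)" using M(1)[of "\<^bold>\<not> A"] A Th(2)[of "\<^bold>\<not> A"] by simp
  ultimately show False by simp
qed

section \<open>Values of terms in a model\<close>

text \<open>
  The reading of \<open>Val\<close> in a model, free of de Bruijn indices.
\<close>
primrec term_val :: "('a \<Rightarrow> 'a \<Rightarrow> 'a \<Rightarrow> bool) \<Rightarrow> ('a \<Rightarrow> 'a \<Rightarrow> 'a \<Rightarrow> 'a \<Rightarrow> bool) \<Rightarrow> ('a \<Rightarrow> 'a \<Rightarrow> 'a \<Rightarrow> bool) \<Rightarrow>
    (fixed \<Rightarrow> 'a) \<Rightarrow> ('v \<Rightarrow> 'a) \<Rightarrow> 'v tm \<Rightarrow> 'a \<Rightarrow> bool"
  and line_val :: "('a \<Rightarrow> 'a \<Rightarrow> 'a \<Rightarrow> bool) \<Rightarrow> ('a \<Rightarrow> 'a \<Rightarrow> 'a \<Rightarrow> 'a \<Rightarrow> bool) \<Rightarrow> ('a \<Rightarrow> 'a \<Rightarrow> 'a \<Rightarrow> bool) \<Rightarrow>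
    (fixed \<Rightarrow> 'a) \<Rightarrow> ('v \<Rightarrow> 'a) \<Rightarrow> 'v ln \<Rightarrow> 'a \<Rightarrow> 'a \<Rightarrow> bool"
  and circle_val :: "('a \<Rightarrow> 'a \<Rightarrow> 'a \<Rightarrow> bool) \<Rightarrow> ('a \<Rightarrow> 'a \<Rightarrow> 'a \<Rightarrow> 'a \<Rightarrow> bool) \<Rightarrow> ('a \<Rightarrow> 'a \<Rightarrow> 'a \<Rightarrow> bool) \<Rightarrow>
    (fixed \<Rightarrow> 'a) \<Rightarrow> ('v \<Rightarrow> 'a) \<Rightarrow> 'v ci \<Rightarrow> 'a \<Rightarrow> 'a \<Rightarrow> 'a \<Rightarrow> bool"
  where
  "term_val B C L F g (Given v) z = (z = g v)"
| "term_val B C L F g (Const c) z = (z = F c)"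
| "term_val B C L F g (LineLine k l) z = (\<exists>a b c d. line_val B C L F g k a b \<and> line_val B C L F g l c d \<and>
     \<not> (on_line B a c d \<and> on_line B b c d) \<and> on_line B z a b \<and> on_line B z c d)"
| "term_val B C L F g (LineCirc1 k s) z = (\<exists>a b c p q. line_val B C L F g k a b \<and> circle_val B C L F g s c p q \<and>
     on_line B z a b \<and> C c z p q \<and> (\<forall>w. on_line B w a b \<and> C c w p q \<longrightarrow> precedes B a b z w))"
| "term_val B C L F g (LineCirc2 k s) z = (\<exists>a b c p q. line_val B C L F g k a b \<and> circle_val B C L F g s c p q \<and>
     on_line B z a b \<and> C c z p q \<and> (\<forall>w. on_line B w a b \<and> C c w p q \<longrightarrow> precedes B a b w z))"
| "term_val B C L F g (CircCirc1 s t) z = (\<exists>c p q d u v. circle_val B C L F g s c p q \<and> circle_val B C L F g t d u v \<and>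
     c \<noteq> d \<and> C c z p q \<and> C d z u v \<and> \<not> L d c z)"
| "term_val B C L F g (CircCirc2 s t) z = (\<exists>c p q d u v. circle_val B C L F g s c p q \<and> circle_val B C L F g t d u v \<and>
     c \<noteq> d \<and> C c z p q \<and> C d z u v \<and> \<not> L c d z)"
| "line_val B C L F g (Line t u) a b = (term_val B C L F g t a \<and> term_val B C L F g u b \<and> a \<noteq> b)"
| "circle_val B C L F g (Circle t u v) c p q = (term_val B C L F g t c \<and> term_val B C L F g u p \<and> term_val B C L F g v q)"

lemma sat_Val [simp]:
  "sat B C L F e (Val g t z) \<longleftrightarrow> term_val B C L F (\<lambda>v. pt_val F e (g v)) t (pt_val F e z)"
  "sat B C L F e (LnVal g l a b) \<longleftrightarrow> line_val B C L F (\<lambda>v. pt_val F e (g v)) l (pt_val F e a) (pt_val F e b)"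
  "sat B C L F e (CiVal g s c p q) \<longleftrightarrow>
    circle_val B C L F (\<lambda>v. pt_val F e (g v)) s (pt_val F e c) (pt_val F e p) (pt_val F e q)"
  by (induction t and l and s arbitrary: e g z and e g a b and e g c p q) (simp_all add: Let_def)

lemma sub_pt_up_case [simp]: "sub_pt (case_nat t s) (up (Suc n) p) = sub_pt s (up n p)"
  by (cases p) auto
lemma sub_pt_up_case_numeral [simp]:
  "sub_pt (case_nat t s) (up (numeral n) p) = sub_pt s (up (pred_numeral n) p)"
  by (simp add: numeral_eq_Suc)
lemma sub_Val [simp]:
  "sub s (Val g t z) = Val (sub_pt s \<circ> g) t (sub_pt s z)"
  "sub s (LnVal g l a b) = LnVal (sub_pt s \<circ> g) l (sub_pt s a) (sub_pt s b)"
  "sub s (CiVal g k c p q) = CiVal (sub_pt s \<circ> g) k (sub_pt s c) (sub_pt s p) (sub_pt s q)"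
  by (induction t and l and k arbitrary: s g z and s g a b and s g c p q)
    (simp_all add: Let_def o_def numeral_eq_Suc)

lemma stable_foralls_Val [simp]: "stable_foralls (Val g t z)" "stable_foralls (LnVal g l a b)" "stable_foralls (CiVal g s c p q)"
  by (induction t and l and s arbitrary: g z and g a b and g c p q) (simp_all add: Let_def)

section \<open>The reflection as a term\<close>

text \<open>
  The endpoint of the extension of \<open>tu\<close> beyond \<open>u\<close> by \<open>vw\<close>.
\<close>
definition extend :: "'v tm \<Rightarrow> 'v tm \<Rightarrow> 'v tm \<Rightarrow> 'v tm \<Rightarrow> 'v tm" where
  "extend t u v w = LineCirc2 (Line t u) (Circle u v w)"

text \<open>
  In this order, the points \<open>a0\<close>, \<open>m\<close>, \<open>c\<close>, \<open>q\<close>, \<open>q'\<close>, \<open>y\<close> of \<open>reflection_construction\<close> and the reflection itself.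
  Exchanging the two circles in a term exchanges the side on which the intersection is taken.
\<close>
definition "beyond_tm = extend (Given LinePoint2) (Given LinePoint1) (Given LinePoint1) (Given LinePoint2)"
definition "foot_tm = extend (Given LinePoint1) beyond_tm (Given LinePoint1) (Given Point)"
definition "far_tm = extend (Given LinePoint1) foot_tm foot_tm (Given LinePoint1)"
definition "left_apex_tm = CircCirc1 (Circle far_tm far_tm (Given LinePoint1)) (Circle (Given LinePoint1) far_tm (Given LinePoint1))"
definition "right_apex_tm = CircCirc1 (Circle (Given LinePoint1) (Given LinePoint1) far_tm) (Circle far_tm (Given LinePoint1) far_tm)"
definition "mirrored_tm = CircCirc1 (Circle right_apex_tm right_apex_tm (Given Point)) (Circle left_apex_tm left_apex_tm (Given Point))"
definition "reflect_tm = extend mirrored_tm foot_tm foot_tm mirrored_tm"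

context geometry
begin

text \<open>
  Subterms occur repeatedly in a term. Being single-valued is what makes all occurrences denote one point.
\<close>
definition single_valued :: "(fixed \<Rightarrow> 'a) \<Rightarrow> ('v \<Rightarrow> 'a) \<Rightarrow> 'v tm \<Rightarrow> bool" where
  "single_valued F g t \<longleftrightarrow> (\<forall>z z'. term_val B C L F g t z \<longrightarrow> term_val B C L F g t z' \<longrightarrow> z = z')"

lemma single_valued_Given: "single_valued F g (Given v)" by (simp add: single_valued_def)

lemma term_val_extend:
  assumes "single_valued F g u" "term_val B C L F g (extend t u v w) z"
  shows "\<exists>a b p r. term_val B C L F g t a \<and> term_val B C L F g u b \<and> term_val B C L F g v p \<and> term_val B C L F g w r \<and>
    a \<noteq> b \<and> bw a b z \<and> C b z p r"
proof -
  obtain a b c p r where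
    v: "term_val B C L F g t a" "term_val B C L F g u b" "a \<noteq> b" "term_val B C L F g u c"
      "term_val B C L F g v p" "term_val B C L F g w r"
    and z: "C c z p r" "\<And>w. on w a b \<Longrightarrow> C c w p r \<Longrightarrow> precedes B a b w z"
    using assms(2) by (auto simp: extend_def)
  moreover have "c = b" using assms(1) v unfolding single_valued_def by blast
  ultimately show ?thesis using last_point_bw[of a b z p r] by blast
qed

lemma single_valued_extend:
  assumes "single_valued F g t" "single_valued F g u" "single_valued F g v" "single_valued F g w" shows "single_valued F g (extend t u v w)"
  unfolding single_valued_def
proof (intro allI impI)
  fix z z' assume z: "term_val B C L F g (extend t u v w) z" and z': "term_val B C L F g (extend t u v w) z'"
  obtain a b p r where 1: "term_val B C L F g t a" "term_val B C L F g u b" "term_val B C L F g v p"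
     "term_val B C L F g w r" "a \<noteq> b" "bw a b z" "C b z p r"
    using term_val_extend[OF assms(2) z] by blast
  obtain a' b' p' r' where 2: "term_val B C L F g t a'" "term_val B C L F g u b'" "term_val B C L F g v p'"
     "term_val B C L F g w r'" "bw a' b' z'" "C b' z' p' r'"
    using term_val_extend[OF assms(2) z'] by blast
  have "a = a'" "b = b'" "p = p'" "r = r'" using assms 1 2 unfolding single_valued_def by blast+
  then show "z = z'" using ext_unique 1 2 C_len by metis
qed

lemma single_valued_CircCirc1:
  assumes "single_valued F g t" "single_valued F g u" "single_valued F g v" "single_valued F g t'" "single_valued F g u'" "single_valued F g v'"
  shows "single_valued F g (CircCirc1 (Circle t u v) (Circle t' u' v'))"
  unfolding single_valued_def
proof (intro allI impI)
  fix z z' assume "term_val B C L F g (CircCirc1 (Circle t u v) (Circle t' u' v')) z"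
    "term_val B C L F g (CircCirc1 (Circle t u v) (Circle t' u' v')) z'"
  then obtain c p r d p' r' c2 p2 r2 d2 p2' r2' where *:
     "term_val B C L F g t c" "term_val B C L F g u p" "term_val B C L F g v r"
     "term_val B C L F g t' d" "term_val B C L F g u' p'" "term_val B C L F g v' r'"
     "term_val B C L F g t c2" "term_val B C L F g u p2" "term_val B C L F g v r2"
     "term_val B C L F g t' d2" "term_val B C L F g u' p2'" "term_val B C L F g v' r2'"
     and **: "c \<noteq> d" "C c z p r" "C d z p' r'" "\<not> L d c z" "C c2 z' p2 r2" "C d2 z' p2' r2'" "\<not> L d2 c2 z'"
    by auto
  have "c2 = c" "p2 = p" "r2 = r" "d2 = d" "p2' = p'" "r2' = r'"
    using assms * unfolding single_valued_def by blast+
  with ** show "z = z'" by (intro left_circles_unique[of c d z z']) (simp_all add: C_len)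
qed

lemma term_val_reflect:
  assumes z: "term_val B C L F g reflect_tm z" and ab: "g LinePoint1 \<noteq> g LinePoint2"
  shows "\<exists>a0 m c q q' y. reflection_construction B C L (g LinePoint1) (g LinePoint2) (g Point) a0 m c q q' y \<and>
    bw y m z \<and> C m z m y"
proof -
  have d0: "single_valued F g beyond_tm" unfolding beyond_tm_def by (intro single_valued_extend single_valued_Given)
  have dm: "single_valued F g foot_tm" unfolding foot_tm_def by (intro single_valued_extend single_valued_Given d0)
  have dc: "single_valued F g far_tm" unfolding far_tm_def by (intro single_valued_extend single_valued_Given dm)
  have dq: "single_valued F g left_apex_tm" "single_valued F g right_apex_tm" unfolding left_apex_tm_def right_apex_tm_def by (intro single_valued_CircCirc1 single_valued_Given dc)+
  have dy: "single_valued F g mirrored_tm" unfolding mirrored_tm_def by (intro single_valued_CircCirc1 single_valued_Given dq)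
  obtain y m where y: "term_val B C L F g mirrored_tm y" and m: "term_val B C L F g foot_tm m" and
    z: "bw y m z" "C m z m y"
    using term_val_extend[OF dm z[unfolded reflect_tm_def]] dm dy unfolding single_valued_def by metis
  obtain a0 where a0: "term_val B C L F g beyond_tm a0"
    and m': "bw (g LinePoint1) a0 m" "C a0 m (g LinePoint1) (g Point)"
    using term_val_extend[OF d0 m[unfolded foot_tm_def]] by auto
  have a0': "bw (g LinePoint2) (g LinePoint1) a0" "C (g LinePoint1) a0 (g LinePoint1) (g LinePoint2)"
    using term_val_extend[OF single_valued_Given a0[unfolded beyond_tm_def]] by auto
  obtain q q' where q: "term_val B C L F g left_apex_tm q" and q': "term_val B C L F g right_apex_tm q'"
    and y': "C q' y q' (g Point)" "C q y q (g Point)" "\<not> L q q' y"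
    using y dq unfolding mirrored_tm_def single_valued_def by (clarsimp, metis)
  obtain c where c: "term_val B C L F g far_tm c" and q2: "C c q c (g LinePoint1)"
     "C (g LinePoint1) q c (g LinePoint1)" "\<not> L (g LinePoint1) c q"
    using q dc unfolding left_apex_tm_def single_valued_def by (clarsimp, metis)
  have q2': "C (g LinePoint1) q' (g LinePoint1) c" "C c q' (g LinePoint1) c" "\<not> L c (g LinePoint1) q'"
    using q' dc c unfolding right_apex_tm_def single_valued_def by (clarsimp, metis)+
  have c': "bw (g LinePoint1) m c" "C m c m (g LinePoint1)"
    using term_val_extend[OF dm c[unfolded far_tm_def]] dm m unfolding single_valued_def by (clarsimp, metis)+
  have "reflection_construction B C L (g LinePoint1) (g LinePoint2) (g Point) a0 m c q q' y"
    by unfold_locales (fact ab a0' m' c' q2 q2' y')+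
  then show ?thesis using z by blast
qed

end

section \<open>Deriving the existence of points\<close>

lemma ExI_sub: "X; H \<turnstile> sub (case_nat t s) A \<Longrightarrow> X; H \<turnstile> sub s (\<^bold>\<exists> A)"
  by (simp, rule ExI[where t = t], simp add: inst_sub_under)

lemma inst_eq: "inst t A = sub (case_nat t Var) A"
  unfolding inst_def ..

lemma pt_bound_up [simp]: "pt_bound p \<le> k \<Longrightarrow> pt_bound (up (Suc 0) p) \<le> Suc k"
  by (cases p) auto

lemma bounded_I:
  "bounded k \<^bold>\<bottom>"
  "bounded k A \<Longrightarrow> bounded k A' \<Longrightarrow> bounded k (A \<^bold>\<and> A')"
  "bounded k A \<Longrightarrow> bounded k A' \<Longrightarrow> bounded k (A \<^bold>\<longrightarrow> A')"
  "pt_bound a \<le> k \<Longrightarrow> pt_bound b \<le> k \<Longrightarrow> bounded k (a \<^bold>= b)"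
  "pt_bound a \<le> k \<Longrightarrow> pt_bound b \<le> k \<Longrightarrow> pt_bound c \<le> k \<Longrightarrow> bounded k (T a b c)"
  "pt_bound a \<le> k \<Longrightarrow> pt_bound b \<le> k \<Longrightarrow> pt_bound c \<le> k \<Longrightarrow> bounded k (Lft a b c)"
  "pt_bound a \<le> k \<Longrightarrow> pt_bound b \<le> k \<Longrightarrow> pt_bound c \<le> k \<Longrightarrow> pt_bound d \<le> k \<Longrightarrow> bounded k (Cong a b c d)"
  by (simp_all add: bounded_def sub_pt_cong cong: conj_cong) (metis sub_pt_cong)+

lemma bounded_Exists: "bounded (Suc k) A \<Longrightarrow> bounded k (\<^bold>\<exists> A)"
  unfolding bounded_def by (auto simp: under_def split: nat.split)

lemma sub_Defined: "sub s (Defined g t) = Defined (sub_pt s \<circ> g) t"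
  by (simp add: Defined_def o_def)

lemma bounded_Defined: "(\<And>v. pt_bound (g v) \<le> k) \<Longrightarrow> bounded k (Defined g t)"
  unfolding bounded_def sub_Defined
  by (intro allI impI arg_cong[where f = "\<lambda>g. Defined g t"] ext) (auto intro: sub_pt_cong)

text \<open>
  A derivation may go on with a new point \<open>Var k\<close> as soon as the condition for its existence is derived.
\<close>
lemma obtain_extension:
  assumes ne: "Ax; H \<turnstile> a \<^bold>\<noteq> b" and G: "Ax; insert (T a b (Var k) \<^bold>\<and> Cong b (Var k) c d) H \<turnstile> G"
    and bd: "\<forall>B\<in>H. bounded k B" "bounded k G"
      "pt_bound a \<le> k" "pt_bound b \<le> k" "pt_bound c \<le> k" "pt_bound d \<le> k"
  shows "Ax; H \<turnstile> G"
proof (rule exE_fresh[OF Ax_closed])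
  show "Ax; H \<turnstile> \<^bold>\<exists> (T (up 1 a) (up 1 b) (Var 0) \<^bold>\<and> Cong (up 1 b) (Var 0) (up 1 c) (up 1 d))"
    using neutral.extension[of a b c d] by (intro ImpE[OF Axiom ne]) (simp add: Let_def)
  show "bounded (Suc k) (T (up 1 a) (up 1 b) (Var 0) \<^bold>\<and> Cong (up 1 b) (Var 0) (up 1 c) (up 1 d))"
    using bd by (auto intro!: bounded_I)
qed (use bd G in \<open>auto simp: inst_eq sub_pt_Var\<close>)

lemma obtain_left_intersection:
  assumes x: "Ax; H \<turnstile> c \<^bold>\<noteq> d \<^bold>\<and> Cong c x p q \<^bold>\<and> Cong d x r s"
    and G: "Ax; insert (Cong c (Var k) p q \<^bold>\<and> Cong d (Var k) r s \<^bold>\<and> \<^bold>\<not> Lft d c (Var k)) H \<turnstile> G"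
    and bd: "\<forall>B\<in>H. bounded k B" "bounded k G"
      "pt_bound c \<le> k" "pt_bound p \<le> k" "pt_bound q \<le> k" "pt_bound d \<le> k" "pt_bound r \<le> k" "pt_bound s \<le> k"
  shows "Ax; H \<turnstile> G"
proof (rule exE_fresh[OF Ax_closed])
  let ?A = "Cong (up 1 c) (Var 0) (up 1 p) (up 1 q) \<^bold>\<and> Cong (up 1 d) (Var 0) (up 1 r) (up 1 s) \<^bold>\<and>
    \<^bold>\<not> Lft (up 1 d) (up 1 c) (Var 0)"
  show "Ax; H \<turnstile> \<^bold>\<exists> ?A"
    using handedness.left_intersection[of c d x p q r s] by (intro ImpE[OF Axiom x]) (simp add: Let_def)
  show "bounded (Suc k) ?A" using bd by (auto intro!: bounded_I)
qed (use bd G in \<open>auto simp: inst_eq sub_pt_Var\<close>)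

text \<open>
  Circle-circle continuity asks for witnesses of the two inequalities. For circles about \<open>a\<close> and \<open>b\<close> through
  each other's center, the point \<open>a\<close> serves as both, once \<open>ba\<close> has been extended beyond \<open>a\<close> by \<open>ab\<close>.
\<close>
lemma obtain_equilateral:
  assumes ne: "Ax; H \<turnstile> a \<^bold>\<noteq> b"
    and G: "Ax; insert (Cong a (Var k) a b \<^bold>\<and> Cong b (Var k) a b) H \<turnstile> G"
    and bd: "\<forall>B\<in>H. bounded k B" "bounded k G" "pt_bound a \<le> k" "pt_bound b \<le> k"
  shows "Ax; H \<turnstile> G"
proof (rule exE_fresh[OF Ax_closed])
  let ?A = "Cong (up 1 a) (Var 0) (up 1 a) (up 1 b) \<^bold>\<and> Cong (up 1 b) (Var 0) (up 1 a) (up 1 b)"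
  let ?v = "Var k"
  let ?K = "{T b a ?v \<^bold>\<and> Cong a ?v a b, a \<^bold>\<noteq> b}"
  have "Ax; ?K \<turnstile> a \<^bold>\<noteq> b" by (rule Hyp) simp
  moreover have "Ax; ?K \<turnstile> Cong a b a b"
    by (rule derivable_if_valid) (auto simp: geometry.C_len)
  moreover have "Ax; ?K \<turnstile> Cong a ?v a b" by (rule AndE2[OF Hyp]) simp
  moreover have "Ax; ?K \<turnstile> T a a b \<^bold>\<and> Cong b b a a"
    by (rule derivable_if_valid) (simp_all add: weakly_between_def, metis geometry.C_len geometry.len_point)
  then have "Ax; ?K \<turnstile> Le b b a b"
    unfolding Le_def Let_def by (intro ExI[where t = a]) (simp add: inst_eq sub_pt_Var)
  moreover have "Ax; ?K \<turnstile> T b a ?v \<^bold>\<and> Cong a b b a"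
    by (rule derivable_if_valid) (auto intro: geometry.cong_swap)
  then have "Ax; ?K \<turnstile> Le a b b ?v"
    unfolding Le_def Let_def by (intro ExI[where t = a]) (simp add: inst_eq sub_pt_Var)
  ultimately have prem: "Ax; ?K \<turnstile> a \<^bold>\<noteq> b \<^bold>\<and> Cong a b a b \<^bold>\<and> Cong a ?v a b \<^bold>\<and> Le b b a b \<^bold>\<and> Le a b b ?v"
    by (intro AndI)
  have ex: "Ax; ?K \<turnstile> \<^bold>\<exists> ?A"
    by (rule ImpE_axiom[OF _ prem]) (use neutral.circle_circle[of a b b a b ?v a b] in \<open>simp add: Let_def\<close>)
  have A: "bounded (Suc k) ?A" using bd by (auto intro!: bounded_I)
  have "Ax; {a \<^bold>\<noteq> b} \<turnstile> \<^bold>\<exists> ?A"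
  proof (rule obtain_extension[where a = b and b = a and c = a and d = b and k = k])
    show "Ax; {a \<^bold>\<noteq> b} \<turnstile> b \<^bold>\<noteq> a" by (rule derivable_if_valid) auto
  qed (use ex bd bounded_Exists[OF A] in \<open>auto intro!: bounded_I\<close>)
  then show "Ax; H \<turnstile> \<^bold>\<exists> ?A" using cut_set[of "{a \<^bold>\<noteq> b}"] ne by blast
  show "bounded (Suc k) ?A" by (rule A)
qed (use bd G in \<open>auto simp: inst_eq sub_pt_Var\<close>)

text \<open>
  The universally quantified clause of \<open>Val\<close>, that \<open>z\<close> is the last intersection, is stable and
  therefore follows from classical validity.
\<close>
lemma Val_extendI:
  assumes V: "Ax; H \<turnstile> Val g t a" "Ax; H \<turnstile> Val g u b" "Ax; H \<turnstile> Val g v p" "Ax; H \<turnstile> Val g w r"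
    and ab: "Ax; H \<turnstile> a \<^bold>\<noteq> b" and z: "Ax; H \<turnstile> T a b z \<^bold>\<and> Cong b z p r"
  shows "Ax; H \<turnstile> Val g (extend t u v w) z"
proof -
  let ?P = "\<^bold>\<forall> (On (Var 0) (up 1 a) (up 1 b) \<^bold>\<and> Cong (up 1 b) (Var 0) (up 1 p) (up 1 r) \<^bold>\<longrightarrow>
    Precedes (up 1 a) (up 1 b) (Var 0) (up 1 z))"
  have last: "Ax; {a \<^bold>\<noteq> b, T a b z \<^bold>\<and> Cong b z p r} \<turnstile> On z a b \<^bold>\<and> ?P"
  proof (rule derivable_if_valid)
    fix B :: "nat \<Rightarrow> nat \<Rightarrow> nat \<Rightarrow> bool" and C L F and e :: "nat \<Rightarrow> nat"
    assume "geometry B C L" and H: "\<forall>h\<in>{a \<^bold>\<noteq> b, T a b z \<^bold>\<and> Cong b z p r}. sat B C L F e h"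
    then interpret geometry B C L by simp
    from H show "sat B C L F e (On z a b \<^bold>\<and> ?P)"
      using bw_last_point[of "pt_val F e a" "pt_val F e b" "pt_val F e z" "pt_val F e p" "pt_val F e r"]
        on_col[of "pt_val F e a" "pt_val F e b" "pt_val F e z"] by (auto simp: col_def)
  qed auto
  have "Ax; H \<turnstile> On z a b \<^bold>\<and> ?P"
    by (rule cut_set[OF _ last]) (use ab z in auto)
  then have on: "Ax; H \<turnstile> On z a b" and P: "Ax; H \<turnstile> ?P" by (auto intro: AndE1 AndE2)
  have "Ax; H \<turnstile> sub Var (Val g (extend t u v w) z)"
    unfolding extend_def Val.simps Let_def
    apply (rule ExI_sub[where t = a], rule ExI_sub[where t = b], rule ExI_sub[where t = b],
        rule ExI_sub[where t = p], rule ExI_sub[where t = r])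
    using V ab on P AndE2[OF z] by (auto simp: sub_pt_Var o_def intro!: AndI)
  then show ?thesis by (simp only: sub_Var)
qed

lemma Val_CircCirc1I:
  assumes V: "Ax; H \<turnstile> Val g t c" "Ax; H \<turnstile> Val g u p" "Ax; H \<turnstile> Val g v q"
      "Ax; H \<turnstile> Val g t' d" "Ax; H \<turnstile> Val g u' r" "Ax; H \<turnstile> Val g v' s"
    and cd: "Ax; H \<turnstile> c \<^bold>\<noteq> d" and z: "Ax; H \<turnstile> Cong c z p q \<^bold>\<and> Cong d z r s \<^bold>\<and> \<^bold>\<not> Lft d c z"
  shows "Ax; H \<turnstile> Val g (CircCirc1 (Circle t u v) (Circle t' u' v')) z"
proof -
  have "Ax; H \<turnstile> sub Var (Val g (CircCirc1 (Circle t u v) (Circle t' u' v')) z)"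
    unfolding Val.simps Let_def
    apply (rule ExI_sub[where t = c], rule ExI_sub[where t = p], rule ExI_sub[where t = q],
        rule ExI_sub[where t = d], rule ExI_sub[where t = r], rule ExI_sub[where t = s])
    using V cd AndE1[OF z] AndE1[OF AndE2[OF z]] AndE2[OF AndE2[OF z]]
    by (auto simp: sub_pt_Var o_def intro!: AndI)
  then show ?thesis by (simp only: sub_Var)
qed

section \<open>The reflection is defined and correct\<close>

lemma geometry_nondegenerate:
  assumes "geometry B C L" "a \<noteq> b"
  shows "C u v a b \<Longrightarrow> u \<noteq> v" "weakly_between B a b c \<Longrightarrow> a \<noteq> c"
  using assms geometry.C_len geometry.len_null geometry.len_sym geometry.bw_aba by metis+

text \<open>
  The construction is carried out step by step inside the calculus. Existence comes from the axioms, without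
  case distinctions; the conditions under which they apply are negations of equalities, hence stable, and
  come from the classical lemmas.
\<close>
lemma reflection_defined:
  "Ax; {Var 1 \<^bold>\<noteq> Var 0} \<turnstile> Defined (point_and_line (Var 2) (Var 1) (Var 0)) reflect_tm"
proof -
  let ?b = "Var 0" and ?a = "Var 1" and ?x = "Var 2" and ?n = "Var 3" and ?m = "Var 4" and ?c = "Var 5"
    and ?w = "Var 6" and ?q = "Var 7" and ?q' = "Var 8" and ?y = "Var 9" and ?z = "Var 10"
  define g where "g = point_and_line ?x ?a ?b"
  define G where "G = Defined g reflect_tm"
  have g: "g Point = ?x" "g LinePoint1 = ?a" "g LinePoint2 = ?b" by (simp_all add: g_def)
  have G: "bounded k G" if "3 \<le> k" for k
    unfolding G_def
  proof (rule bounded_Defined)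
    show "pt_bound (g v) \<le> k" for v using that by (cases v) (simp_all add: g_def)
  qed
  \<comment> \<open>The hypotheses after each step; \<open>n\<close> is the point \<open>a0\<close> of the construction, \<open>w\<close> an auxiliary common point of two circles.\<close>
  define H0 where "H0 = {?a \<^bold>\<noteq> ?b}"
  define H1 where "H1 = insert (T ?b ?a ?n \<^bold>\<and> Cong ?a ?n ?a ?b) H0"
  define H2 where "H2 = insert (T ?a ?n ?m \<^bold>\<and> Cong ?n ?m ?a ?x) H1"
  define H3 where "H3 = insert (T ?a ?m ?c \<^bold>\<and> Cong ?m ?c ?m ?a) H2"
  define H4 where "H4 = insert (Cong ?c ?w ?c ?a \<^bold>\<and> Cong ?a ?w ?c ?a) H3"
  define H5 where "H5 = insert (Cong ?c ?q ?c ?a \<^bold>\<and> Cong ?a ?q ?c ?a \<^bold>\<and> \<^bold>\<not> Lft ?a ?c ?q) H4"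
  define H6 where "H6 = insert (Cong ?a ?q' ?a ?c \<^bold>\<and> Cong ?c ?q' ?a ?c \<^bold>\<and> \<^bold>\<not> Lft ?c ?a ?q') H5"
  define H7 where "H7 = insert (Cong ?q' ?y ?q' ?x \<^bold>\<and> Cong ?q ?y ?q ?x \<^bold>\<and> \<^bold>\<not> Lft ?q ?q' ?y) H6"
  define H8 where "H8 = insert (T ?y ?m ?z \<^bold>\<and> Cong ?m ?z ?m ?y) H7"
  note H_defs = H0_def H1_def H2_def H3_def H4_def H5_def H6_def H7_def H8_def
  note nd = geometry_nondegenerate
  have b_a: "Ax; H0 \<turnstile> ?b \<^bold>\<noteq> ?a" unfolding H_defs by (rule derivable_if_valid) auto
  have a_a0: "Ax; H1 \<turnstile> ?a \<^bold>\<noteq> ?n" unfolding H_defs by (rule derivable_if_valid) (simp_all, metis nd(1))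
  have a_m: "Ax; H2 \<turnstile> ?a \<^bold>\<noteq> ?m"
    by (rule cut[OF weaken[OF a_a0]], force simp: H2_def, unfold H_defs, rule derivable_if_valid)
      (simp_all, metis nd)
  have a_c: "Ax; H3 \<turnstile> ?a \<^bold>\<noteq> ?c"
    by (rule cut[OF weaken[OF a_m]], force simp: H3_def, unfold H_defs, rule derivable_if_valid)
      (simp_all, metis nd)
  have "Ax; {?a \<^bold>\<noteq> ?c} \<turnstile> ?c \<^bold>\<noteq> ?a" by (rule derivable_if_valid) auto
  then have c_a: "Ax; H3 \<turnstile> ?c \<^bold>\<noteq> ?a" using cut_set[of "{?a \<^bold>\<noteq> ?c}"] a_c by blast
  let ?w1 = "?c \<^bold>\<noteq> ?a \<^bold>\<and> Cong ?c ?w ?c ?a \<^bold>\<and> Cong ?a ?w ?c ?a"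
    and ?w2 = "?a \<^bold>\<noteq> ?c \<^bold>\<and> Cong ?a ?w ?a ?c \<^bold>\<and> Cong ?c ?w ?a ?c"
  \<comment> \<open>\<open>w\<close> witnesses that the circles meet, for both orders of the circles.\<close>
  have w1: "Ax; H4 \<turnstile> ?w1"
    using weaken[OF c_a, of H4] by (auto simp: H4_def intro: AndI Hyp)
  have "Ax; {?w1} \<turnstile> ?w2"
    by (rule derivable_if_valid) (simp_all add: geometry.C_len, metis geometry.len_sym)
  then have "Ax; H4 \<turnstile> ?w2" using cut_set[of "{?w1}"] w1 by blast
  then have w2: "Ax; H5 \<turnstile> ?w2" by (rule weaken) (auto simp: H5_def)
  have qs: "Ax; {Cong ?c ?q ?c ?a \<^bold>\<and> Cong ?a ?q ?c ?a \<^bold>\<and> \<^bold>\<not> Lft ?a ?c ?q,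
      Cong ?a ?q' ?a ?c \<^bold>\<and> Cong ?c ?q' ?a ?c \<^bold>\<and> \<^bold>\<not> Lft ?c ?a ?q', ?c \<^bold>\<noteq> ?a} \<turnstile>
      ?q' \<^bold>\<noteq> ?q \<^bold>\<and> Cong ?q' ?x ?q' ?x \<^bold>\<and> Cong ?q ?x ?q ?x"
  proof (rule derivable_if_valid, goal_cases)
    case (5 B C L F e)
    then interpret geometry B C L by simp
    from 5 show ?case
      using left_apexes_distinct(3)[of "e 5" "e 1" "e 7" "e 8"] by (auto simp: C_len)
  qed simp_all
  have q_q': "Ax; H6 \<turnstile> ?q' \<^bold>\<noteq> ?q \<^bold>\<and> Cong ?q' ?x ?q' ?x \<^bold>\<and> Cong ?q ?x ?q ?x"
  proof (rule cut_set[OF _ qs])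
    fix A assume "A \<in> {Cong ?c ?q ?c ?a \<^bold>\<and> Cong ?a ?q ?c ?a \<^bold>\<and> \<^bold>\<not> Lft ?a ?c ?q,
      Cong ?a ?q' ?a ?c \<^bold>\<and> Cong ?c ?q' ?a ?c \<^bold>\<and> \<^bold>\<not> Lft ?c ?a ?q', ?c \<^bold>\<noteq> ?a}"
    then show "Ax; H6 \<turnstile> A"
      using weaken[OF c_a, of H6] by (auto simp: H6_def H5_def H4_def intro: Hyp)
  qed simp
  have y_m: "Ax; H7 \<turnstile> ?y \<^bold>\<noteq> ?m"
  proof (rule derivable_if_valid)
    fix B :: "nat \<Rightarrow> nat \<Rightarrow> nat \<Rightarrow> bool" and C L F and e :: "nat \<Rightarrow> nat"
    assume "geometry B C L" and H: "\<forall>h\<in>H7. sat B C L F e h"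
    then interpret geometry B C L by simp
    have "reflection_construction B C L (e 1) (e 0) (e 2) (e 3) (e 4) (e 5) (e 7) (e 8) (e 9)"
      by unfold_locales (use H in \<open>auto simp: H_defs\<close>)
    then show "sat B C L F e (?y \<^bold>\<noteq> ?m)"
      by (simp add: reflection_construction.y_m)
  qed (simp_all add: H_defs)
  have mono: "H0 \<subseteq> H1" "H1 \<subseteq> H2" "H2 \<subseteq> H3" "H3 \<subseteq> H7" "H7 \<subseteq> H8"
    unfolding H_defs by blast+
  have hyp: "Ax; H8 \<turnstile> T ?b ?a ?n \<^bold>\<and> Cong ?a ?n ?a ?b" "Ax; H8 \<turnstile> T ?a ?n ?m \<^bold>\<and> Cong ?n ?m ?a ?x"
     "Ax; H8 \<turnstile> T ?a ?m ?c \<^bold>\<and> Cong ?m ?c ?m ?a"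
     "Ax; H8 \<turnstile> Cong ?c ?q ?c ?a \<^bold>\<and> Cong ?a ?q ?c ?a \<^bold>\<and> \<^bold>\<not> Lft ?a ?c ?q"
     "Ax; H8 \<turnstile> Cong ?a ?q' ?a ?c \<^bold>\<and> Cong ?c ?q' ?a ?c \<^bold>\<and> \<^bold>\<not> Lft ?c ?a ?q'"
     "Ax; H8 \<turnstile> Cong ?q' ?y ?q' ?x \<^bold>\<and> Cong ?q ?y ?q ?x \<^bold>\<and> \<^bold>\<not> Lft ?q ?q' ?y"
     "Ax; H8 \<turnstile> T ?y ?m ?z \<^bold>\<and> Cong ?m ?z ?m ?y"
    by (rule Hyp, simp add: H_defs)+
  have ne: "Ax; H8 \<turnstile> ?b \<^bold>\<noteq> ?a" "Ax; H8 \<turnstile> ?a \<^bold>\<noteq> ?n" "Ax; H8 \<turnstile> ?a \<^bold>\<noteq> ?m" "Ax; H8 \<turnstile> ?a \<^bold>\<noteq> ?c"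
      "Ax; H8 \<turnstile> ?c \<^bold>\<noteq> ?a" "Ax; H8 \<turnstile> ?y \<^bold>\<noteq> ?m"
    by (rule weaken[OF b_a] weaken[OF a_a0] weaken[OF a_m] weaken[OF a_c] weaken[OF c_a] weaken[OF y_m],
        use mono in blast)+
  have q'_q: "Ax; H8 \<turnstile> ?q' \<^bold>\<noteq> ?q" by (rule AndE1[OF weaken[OF q_q']]) (auto simp: H8_def H7_def)
  have given: "Ax; H8 \<turnstile> Val g (Given LinePoint1) ?a" "Ax; H8 \<turnstile> Val g (Given LinePoint2) ?b"
      "Ax; H8 \<turnstile> Val g (Given Point) ?x"
    using EqI g by simp_all
  have a0: "Ax; H8 \<turnstile> Val g beyond_tm ?n"
    unfolding beyond_tm_def by (rule Val_extendI[OF given(2,1,1,2) ne(1) hyp(1)])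
  have m: "Ax; H8 \<turnstile> Val g foot_tm ?m"
    unfolding foot_tm_def by (rule Val_extendI[OF given(1) a0 given(1,3) ne(2) hyp(2)])
  have c: "Ax; H8 \<turnstile> Val g far_tm ?c"
    unfolding far_tm_def by (rule Val_extendI[OF given(1) m m given(1) ne(3) hyp(3)])
  have q: "Ax; H8 \<turnstile> Val g left_apex_tm ?q"
    unfolding left_apex_tm_def by (rule Val_CircCirc1I[OF c c given(1) given(1) c given(1) ne(5) hyp(4)])
  have q': "Ax; H8 \<turnstile> Val g right_apex_tm ?q'"
    unfolding right_apex_tm_def by (rule Val_CircCirc1I[OF given(1,1) c c given(1) c ne(4) hyp(5)])
  have y: "Ax; H8 \<turnstile> Val g mirrored_tm ?y"
    unfolding mirrored_tm_def by (rule Val_CircCirc1I[OF q' q' given(3) q q given(3) q'_q hyp(6)])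
  have z: "Ax; H8 \<turnstile> Val g reflect_tm ?z"
    unfolding reflect_tm_def by (rule Val_extendI[OF y m m y ne(6) hyp(7)])
  \<comment> \<open>The points of \<open>H8\<close> are the values of the successive terms.\<close>
  have "Ax; H8 \<turnstile> G"
    unfolding G_def Defined_def
    by (rule ExI[where t = ?z]) (use z in \<open>simp add: inst_eq o_def sub_pt_Var\<close>)
  \<comment> \<open>Now the points are discharged in reverse order.\<close>
  then have "Ax; H7 \<turnstile> G" unfolding H8_def
    by (rule obtain_extension[OF y_m]) (auto simp: H_defs intro!: bounded_I G)
  then have "Ax; H6 \<turnstile> G" unfolding H7_def
    by (rule obtain_left_intersection[OF q_q']) (auto simp: H_defs intro!: bounded_I G)
  then have "Ax; H5 \<turnstile> G" unfolding H6_def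
    by (rule obtain_left_intersection[OF w2]) (auto simp: H_defs intro!: bounded_I G)
  then have "Ax; H4 \<turnstile> G" unfolding H5_def
    by (rule obtain_left_intersection[OF w1]) (auto simp: H_defs intro!: bounded_I G)
  then have "Ax; H3 \<turnstile> G" unfolding H4_def
    by (rule obtain_equilateral[OF c_a]) (auto simp: H_defs intro!: bounded_I G)
  then have "Ax; H2 \<turnstile> G" unfolding H3_def
    by (rule obtain_extension[OF a_m]) (auto simp: H_defs intro!: bounded_I G)
  then have "Ax; H1 \<turnstile> G" unfolding H2_def
    by (rule obtain_extension[OF a_a0]) (auto simp: H_defs intro!: bounded_I G)
  then have "Ax; H0 \<turnstile> G" unfolding H1_def
    by (rule obtain_extension[OF b_a]) (auto simp: H_defs intro!: bounded_I G)
  then show ?thesis unfolding H0_def G_def g_def .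
qed

text \<open>
  Unlike definedness, this is a stable formula, so it suffices to verify it in classical models.
\<close>
lemma reflection_correct:
  "Ax; {Var 1 \<^bold>\<noteq> Var 0} \<turnstile> \<^bold>\<forall> \<^bold>\<forall> \<^bold>\<forall> \<^bold>\<forall> (let x = up 4 (Var 2); a = up 4 (Var 1); b = up 4 (Var 0);
                     z = Var 3; k = Var 2; l = Var 1; e = Var 0 in
             Val (point_and_line x a b) reflect_tm z \<^bold>\<and>
             k \<^bold>\<noteq> l \<^bold>\<and> Perp k l a b \<^bold>\<and> On x k l \<^bold>\<and> On e k l \<^bold>\<and> On e a b \<^bold>\<longrightarrow>
               On z k l \<^bold>\<and> Cong e z e x \<^bold>\<and> (\<^bold>\<not> On x a b \<^bold>\<longrightarrow> Bet x e z))"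
proof (rule derivable_if_valid)
  fix B :: "nat \<Rightarrow> nat \<Rightarrow> nat \<Rightarrow> bool" and C L F and e :: "nat \<Rightarrow> nat"
  assume "geometry B C L" and ab: "\<forall>h\<in>{Var 1 \<^bold>\<noteq> Var 0}. sat B C L F e h"
  then interpret geometry B C L by simp
  have main: "on z k l \<and> C d z d (e 2) \<and> (\<not> on (e 2) (e 1) (e 0) \<longrightarrow> B (e 2) d z)"
    if z: "term_val B C L F g reflect_tm z" and g: "g Point = e 2" "g LinePoint1 = e 1" "g LinePoint2 = e 0" and
    K: "k \<noteq> l" "B q0 m0 r0" "C p0 q0 p0 r0" "C q0 m0 m0 r0" "on m0 k l" "on m0 (e 1) (e 0)"
      "p0 \<noteq> m0" "on p0 k l" "on q0 (e 1) (e 0)" "on r0 (e 1) (e 0)"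
      "on (e 2) k l" "on d k l" "on d (e 1) (e 0)"
    for z k l d m0 p0 q0 r0 g
  proof -
    obtain a0 m c q q' y where "reflection_construction B C L (e 1) (e 0) (e 2) a0 m c q q' y"
      and yz: "bw y m z" "C m z m y"
      using term_val_reflect[OF z] ab g by auto
    then interpret reflection_construction B C L "e 1" "e 0" "e 2" a0 m c q q' y by simp
    show ?thesis
      by (rule value_is_mirror_image[OF yz K(1,5,6,7,8,9,10,2,3,4,11,12,13)])
  qed
  show "sat B C L F e (\<^bold>\<forall> \<^bold>\<forall> \<^bold>\<forall> \<^bold>\<forall> (let x = up 4 (Var 2); a = up 4 (Var 1); b = up 4 (Var 0);
                     z = Var 3; k = Var 2; l = Var 1; e = Var 0 in
             Val (point_and_line x a b) reflect_tm z \<^bold>\<and>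
             k \<^bold>\<noteq> l \<^bold>\<and> Perp k l a b \<^bold>\<and> On x k l \<^bold>\<and> On e k l \<^bold>\<and> On e a b \<^bold>\<longrightarrow>
               On z k l \<^bold>\<and> Cong e z e x \<^bold>\<and> (\<^bold>\<not> On x a b \<^bold>\<longrightarrow> Bet x e z)))"
    by (simp add: Let_def Perp_def Perp_at_def, intro allI impI, elim exE conjE,
        rule main[unfolded One_nat_def], assumption, simp, simp, simp, assumption+)
qed (simp_all add: Let_def)

theorem theorem7p4:
  "\<exists>Reflect :: given tm.
    neutral \<union> handedness \<union> euclid5; {} \<turnstile>
      \<^bold>\<forall> \<^bold>\<forall> \<^bold>\<forall> (let x = Var 2; a = Var 1; b = Var 0 in
        a \<^bold>\<noteq> b \<^bold>\<longrightarrow>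
          Defined (point_and_line x a b) Reflect \<^bold>\<and>
          (\<^bold>\<forall> \<^bold>\<forall> \<^bold>\<forall> \<^bold>\<forall> (let x = up 4 x; a = up 4 a; b = up 4 b;
                     z = Var 3; k = Var 2; l = Var 1; e = Var 0 in
             Val (point_and_line x a b) Reflect z \<^bold>\<and>
             k \<^bold>\<noteq> l \<^bold>\<and> Perp k l a b \<^bold>\<and> On x k l \<^bold>\<and> On e k l \<^bold>\<and> On e a b \<^bold>\<longrightarrow>
               On z k l \<^bold>\<and> Cong e z e x \<^bold>\<and> (\<^bold>\<not> On x a b \<^bold>\<longrightarrow> Bet x e z))))"
proof (rule exI[where x = reflect_tm], rule derivable_mono[where X = Ax])
  show "Ax; {} \<turnstile>
      \<^bold>\<forall> \<^bold>\<forall> \<^bold>\<forall> (let x = Var 2; a = Var 1; b = Var 0 in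
        a \<^bold>\<noteq> b \<^bold>\<longrightarrow>
          Defined (point_and_line x a b) reflect_tm \<^bold>\<and>
          (\<^bold>\<forall> \<^bold>\<forall> \<^bold>\<forall> \<^bold>\<forall> (let x = up 4 x; a = up 4 a; b = up 4 b;
                     z = Var 3; k = Var 2; l = Var 1; e = Var 0 in
             Val (point_and_line x a b) reflect_tm z \<^bold>\<and>
             k \<^bold>\<noteq> l \<^bold>\<and> Perp k l a b \<^bold>\<and> On x k l \<^bold>\<and> On e k l \<^bold>\<and> On e a b \<^bold>\<longrightarrow>
               On z k l \<^bold>\<and> Cong e z e x \<^bold>\<and> (\<^bold>\<not> On x a b \<^bold>\<longrightarrow> Bet x e z))))"
    unfolding Let_def
    by (rule AllI, rule AllI, rule AllI, unfold image_empty, rule ImpI, rule AndI,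
        fact reflection_defined, fact reflection_correct[unfolded Let_def])
qed blast

end
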